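(* Let $0<\alpha_i<1$ for $i=0,\dots,n$, let $\Omega=[a_0,b_0]\times[a_1,b_1]\times\cdots\times[a_n,b_n]$, and let $\varphi:\partial\Omega\to\mathbb{R}^m$ be a given function. Let $\mathcal{L}\in C^1(\mathbb{R}^m\times\mathbb{R}^{m(n+1)};\mathbb{R})$, and consider the action functional $$\mathcal{J}(u)=\int_\Omega \mathcal{L}(u,\nabla^\alpha u)\,dx$$ on the set of admissible functions, i.e. all $u=(u_1,\dots,u_m):\Omega\to\mathbb{R}^m$ such that ${_{a_i}D_{x_i}^{\alpha_i}}u_j\in C(\Omega,\mathbb{R})$ for $i=0,\dots,n$, $j=1,\dots,m$, and $u|_{\partial\Omega}=\varphi$. Assume that for all admissible functions $u$ the functions ${_{x_i}D_{b_i}^{\alpha_i}}\frac{\partial\mathcal{L}}{\partial\,{_{a_i}D_{x_i}^{\alpha_i}}u_j}$, $i=0,\dots,n$, $j=1,\dots,m$, are continuous on $(a_0,b_0)\times\cdots\times(a_n,b_n)$ and integrable on $\Omega$. If a function $u$ minimizes the action functional $\mathcal{J}$, then $u$ satisfies the multidimensional fractional Euler--Lagrange differential equations $$\frac{\partial\mathcal{L}}{\partial u_j}+\sum_{i=0}^n {_{x_i}D_{b_i}^{\alpha_i}}\frac{\partial\mathcal{L}}{\partial\,{_{a_i}D_{x_i}^{\alpha_i}}u_j}=0,\qquad j=1,\dots,m.$$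
   Context: Points of $\Omega$ are written $x=(x_0,x_1,\dots,x_n)$ (with $x_0=t$ the time variable), and $dx=dx_0\,dx_1\cdots dx_n$. For a real-valued function $f$ on $\Omega$, the left and right partial Riemann--Liouville fractional derivatives of order $\alpha_k\in(0,1)$ with respect to $x_k$ are $${_{a_k}D_{x_k}^{\alpha_k}}f(x)=\frac{1}{\Gamma(1-\alpha_k)}\frac{\partial}{\partial x_k}\int_{a_k}^{x_k}(x_k-s)^{-\alpha_k}f(x_0,\dots,x_{k-1},s,x_{k+1},\dots,x_n)\,ds,$$ $${_{x_k}D_{b_k}^{\alpha_k}}f(x)=-\frac{1}{\Gamma(1-\alpha_k)}\frac{\partial}{\partial x_k}\int_{x_k}^{b_k}(s-x_k)^{-\alpha_k}f(x_0,\dots,x_{k-1},s,x_{k+1},\dots,x_n)\,ds,$$ where $\Gamma$ is the Gamma function. $\alpha=(\alpha_0,\dots,\alpha_n)$ and $\nabla^\alpha=({_{a_0}D_{x_0}^{\alpha_0}},{_{a_1}D_{x_1}^{\alpha_1}},\dots,{_{a_n}D_{x_n}^{\alpha_n}})$. For vector-valued $u$, $\nabla^\alpha u$ is the collection of all ${_{a_i}D_{x_i}^{\alpha_i}}u_j$, taking values in $\mathbb{R}^{m(n+1)}$. $\frac{\partial\mathcal{L}}{\partial u_j}$ denotes the partial derivative of $\mathcal{L}$ in the slot occupied by $u_j$, and $\frac{\partial\mathcal{L}}{\partial\,{_{a_i}D_{x_i}^{\alpha_i}}u_j}$ the partial derivative of $\mathcal{L}$ in the slot occupied by ${_{a_i}D_{x_i}^{\alpha_i}}u_j$,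 both evaluated at $(u(x),\nabla^\alpha u(x))$ and regarded as functions of $x$.
   Formalization: Admissible functions are also required to be Lebesgue measurable; the equations are proved at almost every interior point and at every interior point where u is continuous, since changing u at one point (e.g. L=u², φ=0) breaks the literal everywhere claim. *)

theory Defs
  imports "HOL-Analysis.Analysis"
begin

definition coord_update :: "real ^ 'n \<Rightarrow> 'n \<Rightarrow> real \<Rightarrow> real ^ 'n" where
  "coord_update x k s = (\<chi> i. if i = k then s else x $ i)"

text \<open>
  Riemann--Liouville derivatives on the box \<open>cbox a b\<close>. The derivative in \<open>x\<^sub>k\<close> is taken within
  \<open>[a\<^sub>k, b\<^sub>k]\<close>, so it is one-sided on the faces of the box and only values of \<open>f\<close> on the box matter.
  The functions \<open>left_RL_deriv\<close>, \<open>right_RL_deriv\<close> are total; that the integral and its derivative really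
  exist at \<open>x\<close> is expressed by \<open>has_left_RL_deriv\<close>, \<open>has_right_RL_deriv\<close>.
\<close>

definition left_RL_integrand ::
    "real \<Rightarrow> 'n \<Rightarrow> (real ^ 'n \<Rightarrow> real) \<Rightarrow> real ^ 'n \<Rightarrow> real \<Rightarrow> real \<Rightarrow> real" where
  "left_RL_integrand \<beta> k f x t s = (t - s) powr (- \<beta>) * f (coord_update x k s)"

definition right_RL_integrand ::
    "real \<Rightarrow> 'n \<Rightarrow> (real ^ 'n \<Rightarrow> real) \<Rightarrow> real ^ 'n \<Rightarrow> real \<Rightarrow> real \<Rightarrow> real" where
  "right_RL_integrand \<beta> k f x t s = (s - t) powr (- \<beta>) * f (coord_update x k s)"

definition left_RL_deriv ::
    "real ^ 'n \<Rightarrow> real ^ 'n \<Rightarrow> real \<Rightarrow> 'n \<Rightarrow> (real ^ 'n \<Rightarrow> real) \<Rightarrow> real ^ 'n \<Rightarrow> real" where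
  "left_RL_deriv a b \<beta> k f x =
     1 / Gamma (1 - \<beta>) *
     vector_derivative (\<lambda>t. integral {a $ k..t} (left_RL_integrand \<beta> k f x t))
       (at (x $ k) within {a $ k..b $ k})"

definition right_RL_deriv ::
    "real ^ 'n \<Rightarrow> real ^ 'n \<Rightarrow> real \<Rightarrow> 'n \<Rightarrow> (real ^ 'n \<Rightarrow> real) \<Rightarrow> real ^ 'n \<Rightarrow> real" where
  "right_RL_deriv a b \<beta> k f x =
     - (1 / Gamma (1 - \<beta>)) *
     vector_derivative (\<lambda>t. integral {t..b $ k} (right_RL_integrand \<beta> k f x t))
       (at (x $ k) within {a $ k..b $ k})"

definition has_left_RL_deriv ::
    "real ^ 'n \<Rightarrow> real ^ 'n \<Rightarrow> real \<Rightarrow> 'n \<Rightarrow> (real ^ 'n \<Rightarrow> real) \<Rightarrow> real ^ 'n \<Rightarrow> bool" where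
  "has_left_RL_deriv a b \<beta> k f x \<longleftrightarrow>
     left_RL_integrand \<beta> k f x (x $ k) absolutely_integrable_on {a $ k..x $ k} \<and>
     (\<lambda>t. integral {a $ k..t} (left_RL_integrand \<beta> k f x t))
       differentiable (at (x $ k) within {a $ k..b $ k})"

definition has_right_RL_deriv ::
    "real ^ 'n \<Rightarrow> real ^ 'n \<Rightarrow> real \<Rightarrow> 'n \<Rightarrow> (real ^ 'n \<Rightarrow> real) \<Rightarrow> real ^ 'n \<Rightarrow> bool" where
  "has_right_RL_deriv a b \<beta> k f x \<longleftrightarrow>
     right_RL_integrand \<beta> k f x (x $ k) absolutely_integrable_on {x $ k..b $ k} \<and>
     (\<lambda>t. integral {t..b $ k} (right_RL_integrand \<beta> k f x t))
       differentiable (at (x $ k) within {a $ k..b $ k})"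

text \<open>Row \<open>j\<close>, column \<open>i\<close> holds the derivative of \<open>u\<^sub>j\<close> in \<open>x\<^sub>i\<close>.\<close>

definition frac_grad ::
    "real ^ 'n \<Rightarrow> real ^ 'n \<Rightarrow> real ^ 'n \<Rightarrow> (real ^ 'n \<Rightarrow> real ^ 'm) \<Rightarrow> real ^ 'n \<Rightarrow> real ^ 'n ^ 'm" where
  "frac_grad a b \<alpha> u x = (\<chi> j i. left_RL_deriv a b (\<alpha> $ i) i (\<lambda>y. u y $ j) x)"

definition C1_function :: "('a::real_normed_vector \<Rightarrow> real) \<Rightarrow> bool" where
  "C1_function f \<longleftrightarrow>
     (\<exists>f' :: 'a \<Rightarrow> 'a \<Rightarrow>\<^sub>L real.
        (\<forall>z. (f has_derivative blinfun_apply (f' z)) (at z)) \<and> continuous_on UNIV f')"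

definition partial_value ::
    "((real ^ 'm) \<times> (real ^ 'n ^ 'm) \<Rightarrow> real) \<Rightarrow> 'm \<Rightarrow> (real ^ 'm) \<times> (real ^ 'n ^ 'm) \<Rightarrow> real" where
  "partial_value L j z = deriv (\<lambda>h. L (fst z + h *\<^sub>R axis j 1, snd z)) 0"

definition partial_grad ::
    "((real ^ 'm) \<times> (real ^ 'n ^ 'm) \<Rightarrow> real) \<Rightarrow> 'm \<Rightarrow> 'n \<Rightarrow>
     (real ^ 'm) \<times> (real ^ 'n ^ 'm) \<Rightarrow> real" where
  "partial_grad L j i z = deriv (\<lambda>h. L (fst z, snd z + h *\<^sub>R axis j (axis i 1))) 0"

text \<open>
  Lebesgue measurability of \<open>u\<close> does not follow from the remaining conditions: if the box has dimension
  at least two, they are insensitive to changing \<open>u\<close> inside the box on a set that meets every line in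
  at most two points, and such a set need not be measurable. For measurable \<open>u\<close> they force \<open>u\<close> to agree
  almost everywhere with a continuous function on the box, so the integral defining \<open>action\<close> exists
  for every admissible function.
\<close>

definition admissible ::
    "real ^ 'n \<Rightarrow> real ^ 'n \<Rightarrow> real ^ 'n \<Rightarrow> (real ^ 'n \<Rightarrow> real ^ 'm) \<Rightarrow>
     (real ^ 'n \<Rightarrow> real ^ 'm) \<Rightarrow> bool" where
  "admissible a b \<alpha> \<phi> u \<longleftrightarrow>
     u \<in> borel_measurable (lebesgue_on (cbox a b)) \<and>
     (\<forall>i j. (\<forall>x\<in>cbox a b. has_left_RL_deriv a b (\<alpha> $ i) i (\<lambda>y. u y $ j) x) \<and>
            continuous_on (cbox a b) (left_RL_deriv a b (\<alpha> $ i) i (\<lambda>y. u y $ j))) \<and>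
     (\<forall>x\<in>frontier (cbox a b). u x = \<phi> x)"

definition action ::
    "real ^ 'n \<Rightarrow> real ^ 'n \<Rightarrow> real ^ 'n \<Rightarrow> ((real ^ 'm) \<times> (real ^ 'n ^ 'm) \<Rightarrow> real) \<Rightarrow>
     (real ^ 'n \<Rightarrow> real ^ 'm) \<Rightarrow> real" where
  "action a b \<alpha> L u = (LINT x:cbox a b|lebesgue. L (u x, frac_grad a b \<alpha> u x))"

definition minimizes_action ::
    "real ^ 'n \<Rightarrow> real ^ 'n \<Rightarrow> real ^ 'n \<Rightarrow> ((real ^ 'm) \<times> (real ^ 'n ^ 'm) \<Rightarrow> real) \<Rightarrow>
     (real ^ 'n \<Rightarrow> real ^ 'm) \<Rightarrow> (real ^ 'n \<Rightarrow> real ^ 'm) \<Rightarrow> bool" where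
  "minimizes_action a b \<alpha> L \<phi> u \<longleftrightarrow>
     admissible a b \<alpha> \<phi> u \<and>
     (\<forall>v. admissible a b \<alpha> \<phi> v \<longrightarrow> action a b \<alpha> L u \<le> action a b \<alpha> L v)"

definition momentum ::
    "real ^ 'n \<Rightarrow> real ^ 'n \<Rightarrow> real ^ 'n \<Rightarrow> ((real ^ 'm) \<times> (real ^ 'n ^ 'm) \<Rightarrow> real) \<Rightarrow>
     (real ^ 'n \<Rightarrow> real ^ 'm) \<Rightarrow> 'm \<Rightarrow> 'n \<Rightarrow> real ^ 'n \<Rightarrow> real" where
  "momentum a b \<alpha> L u j i x = partial_grad L j i (u x, frac_grad a b \<alpha> u x)"

text \<open>
  Membership in \<open>admissible\<close> and the value of \<open>action\<close> do not change when \<open>u\<close> is changed at a single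
  interior point, but \<open>partial_value L j (u x, _)\<close> does. Hence for a minimizer the equation can be
  expected at almost every interior point and at every interior point of continuity of \<open>u\<close>.
\<close>

definition euler_lagrange_at ::
    "real ^ 'n \<Rightarrow> real ^ 'n \<Rightarrow> real ^ 'n \<Rightarrow> ((real ^ 'm) \<times> (real ^ 'n ^ 'm) \<Rightarrow> real) \<Rightarrow>
     (real ^ 'n \<Rightarrow> real ^ 'm) \<Rightarrow> 'm \<Rightarrow> real ^ 'n \<Rightarrow> bool" where
  "euler_lagrange_at a b \<alpha> L u j x \<longleftrightarrow>
     partial_value L j (u x, frac_grad a b \<alpha> u x)
     + (\<Sum>i\<in>UNIV. right_RL_deriv a b (\<alpha> $ i) i (momentum a b \<alpha> L u j i) x) = 0"

end

theory Submission
  imports Defs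
begin

text \<open>
  For a test function \<open>\<eta>\<close> with support inside the box, \<open>u + \<epsilon> \<eta> e\<^sub>j\<close> is admissible, so the derivative of the
  action in \<open>\<epsilon>\<close> vanishes at \<open>0\<close>. Differentiating under the integral needs \<open>u\<close> to be essentially bounded:
  on every line in a fixed coordinate direction \<open>u\<close> solves an Abel integral equation with \<open>C\<^sup>1\<close> right-hand
  side, hence agrees almost everywhere with a fractional integral of its continuous left derivative.
  Fractional integration by parts, line by line, turns the first variation into
  \<open>\<integral> \<eta> (\<partial>L/\<partial>u\<^sub>j + \<Sum>\<^sub>i D\<^sub>i p\<^sub>i) = 0\<close>, where \<open>p\<^sub>i\<close> are the momenta and \<open>D\<^sub>i\<close> the right derivatives.
  Products of one-dimensional bumps converging to the indicator of a box show that the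
  bracket has zero integral over all boxes, so it vanishes almost everywhere, and everywhere where it is continuous.
\<close>

text \<open>The obstacle is that \<open>u\<close> need not be continuous: each derivative condition
  sees \<open>u\<close> only along lines in one coordinate direction. Test functions are products
  because the left derivative in one variable then acts on a single factor, the other factors being
  constant along the line. Their support stays away from the faces, where no right derivative is
  assumed; this removes all boundary terms. The left derivative of a test function is nonlocal,
  however: it need not vanish between the support and the right face, so the momenta have to be
  integrated up to that face. The equation has a plus sign because the minus sign in the definition
  of the right derivative cancels the one from integration by parts. The definitions use Lebesgue
  measure, whose measurable functions may have non-measurable sections. Whenever the order of
  integration changes, functions are first replaced by Borel versions and the measure by
  \<open>lborel\<close>.\<close>

section \<open>Lebesgue integrals along lines\<close>

lemma enn2real_inj_finite:
  assumes "enn2real x = enn2real y" "x \<noteq> \<infinity>" "y \<noteq> \<infinity>"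
  shows "x = y"
  using assms by (cases x; cases y) auto

text \<open>The positive and negative parts of \<open>f\<close> are densities of two finite
  measures. These agree on open boxes, an intersection-stable generator of the Borel sets, hence
  everywhere, and densities are unique almost everywhere. At each point one of the two parts is
  zero, so equality forces both to vanish.\<close>

lemma AE_zero_if_box_integrals_zero:
  fixes f :: "'a::euclidean_space \<Rightarrow> real"
  assumes f: "integrable lborel f"
    and box: "\<And>c d. (LINT x|lborel. indicator (box c d) x * f x) = 0"
  shows "AE x in lborel. f x = 0"
proof -
  have [measurable]: "f \<in> borel_measurable borel" using f by auto
  let ?M = "density lborel (\<lambda>x. ennreal (f x))" and ?N = "density lborel (\<lambda>x. ennreal (- f x))"
  have eq: "emeasure ?M (box c d) = emeasure ?N (box c d)" for c d
  proof -
    let ?g = "\<lambda>x. indicator (box c d) x * f x"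
    have g: "integrable lborel ?g"
      using integrable_mult_indicator[OF _ f, of "box c d"] by simp
    have "emeasure ?M (box c d) = (\<integral>\<^sup>+x. ennreal (?g x) \<partial>lborel)"
      by (subst emeasure_density) (auto intro!: nn_integral_cong simp: indicator_def)
    also have "\<dots> = (\<integral>\<^sup>+x. ennreal (- ?g x) \<partial>lborel)"
    proof -
      have "enn2real (\<integral>\<^sup>+x. ennreal (?g x) \<partial>lborel) = enn2real (\<integral>\<^sup>+x. ennreal (- ?g x) \<partial>lborel)"
        using real_lebesgue_integral_def[OF g] box[of c d] by simp
      moreover have "(\<integral>\<^sup>+x. ennreal (?g x) \<partial>lborel) \<noteq> \<infinity>" "(\<integral>\<^sup>+x. ennreal (- ?g x) \<partial>lborel) \<noteq> \<infinity>"
        using g unfolding real_integrable_def by auto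
      ultimately show ?thesis
        by (intro enn2real_inj_finite) auto
    qed
    also have "\<dots> = emeasure ?N (box c d)"
      by (subst emeasure_density) (auto intro!: nn_integral_cong simp: indicator_def)
    finally show ?thesis .
  qed
  have "?M = ?N"
  proof (rule measure_eqI_generator_eq)
    let ?E = "range (\<lambda>(a, b). box a b::'a set)"
    show "Int_stable ?E"
      by (auto simp: Int_stable_def box_Int_box)
    show "?E \<subseteq> Pow UNIV" "sets ?M = sigma_sets UNIV ?E" "sets ?N = sigma_sets UNIV ?E"
      by (simp_all add: borel_eq_box)
    let ?A = "\<lambda>n::nat. box (- (real n *\<^sub>R One)) (real n *\<^sub>R One) :: 'a set"
    show "range ?A \<subseteq> ?E" "(\<Union>i. ?A i) = UNIV"
      unfolding UN_box_eq_UNIV by auto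
    show "emeasure ?M (?A i) \<noteq> \<infinity>" for i
    proof -
      have "emeasure ?M (?A i) \<le> emeasure ?M UNIV" by (rule emeasure_mono) auto
      also have "\<dots> = (\<integral>\<^sup>+x. ennreal (f x) \<partial>lborel)" by (subst emeasure_density) auto
      also have "\<dots> < \<infinity>" using f unfolding real_integrable_def by (auto simp: less_top)
      finally show ?thesis by simp
    qed
    show "emeasure ?M X = emeasure ?N X" if "X \<in> ?E" for X using that eq by auto
  qed
  then have "AE x in lborel. ennreal (f x) = ennreal (- f x)"
    by (intro sigma_finite_measure.density_unique[OF sigma_finite_lborel]) auto
  then show ?thesis
  proof eventually_elim
    case (elim x)
    have "f x \<le> 0 \<or> - f x \<le> 0" by linarith
    then show ?case
    proof
      assume le: "f x \<le> 0"
      then have "ennreal (f x) = 0" by (rule ennreal_neg)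
      then have "ennreal (- f x) = 0" by (simp only: elim)
      then show ?thesis using le by (simp add: ennreal_eq_0_iff)
    next
      assume le: "- f x \<le> 0"
      then have "ennreal (- f x) = 0" by (rule ennreal_neg)
      then have "ennreal (f x) = 0" by (simp only: elim)
      then show ?thesis using le by (simp add: ennreal_eq_0_iff)
    qed
  qed
qed

text \<open>Entry point for every use of Fubini below: all four properties of the version are needed
  to carry an integral over to \<open>lborel\<close> and the result back.\<close>

lemma lebesgue_integrable_borel_version:
  fixes f :: "'a::euclidean_space \<Rightarrow> real"
  assumes f: "integrable lebesgue f"
  obtains g where "g \<in> borel_measurable borel" "integrable lborel g" "AE x in lborel. f x = g x"
    "AE x in lebesgue. f x = g x" "integral\<^sup>L lborel g = integral\<^sup>L lebesgue f"
proof -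
  obtain g where g: "g \<in> borel_measurable lborel" "AE x in lborel. f x = g x"
    using completion_ex_borel_measurable_real[of f lborel] f by auto
  have ae: "AE x in lebesgue. f x = g x" using g(2) by (rule AE_completion)
  have gl: "g \<in> borel_measurable lebesgue" using g(1) by (simp add: measurable_completion)
  have "integrable lebesgue g"
    using integrable_cong_AE[THEN iffD1, OF _ gl ae f] f by auto
  then have "integrable lborel g" using g(1) integrable_completion by blast
  moreover have "integral\<^sup>L lborel g = integral\<^sup>L lebesgue f"
    using integral_completion[OF g(1)] integral_cong_AE[OF _ gl ae] f by auto
  ultimately show ?thesis using that g ae by auto
qed

lemma integrable_lebesgue_of_lborel:
  fixes f :: "'a::euclidean_space \<Rightarrow> real"
  assumes "integrable lborel f"
  shows "integrable lebesgue f"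
  using assms integrable_completion by blast

lemma integrable_lborel_cong_lebesgue:
  fixes f g :: "'a::euclidean_space \<Rightarrow> real"
  assumes "integrable lebesgue f" "g \<in> borel_measurable borel" "AE x in lborel. f x = g x"
  shows "integrable lborel g" "integral\<^sup>L lborel g = integral\<^sup>L lebesgue f"
proof -
  have gl: "g \<in> borel_measurable lebesgue" using assms(2) by (simp add: measurable_completion)
  have ae: "AE x in lebesgue. f x = g x" using assms(3) by (rule AE_completion)
  have "integrable lebesgue g"
    using integrable_cong_AE[THEN iffD1, OF _ gl ae assms(1)] assms(1) by auto
  then show "integrable lborel g" using assms(2) integrable_completion[of g lborel] by simp
  show "integral\<^sup>L lborel g = integral\<^sup>L lebesgue f"
    using integral_completion[of g lborel] assms integral_cong_AE[OF _ gl ae] by auto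
qed

lemma AE_zero_if_box_integrals_zero_lebesgue:
  fixes f :: "'a::euclidean_space \<Rightarrow> real"
  assumes f: "integrable lebesgue f"
    and box: "\<And>c d. (LINT x|lebesgue. indicator (box c d) x * f x) = 0"
  shows "AE x in lebesgue. f x = 0"
proof -
  obtain g where g: "g \<in> borel_measurable borel" "integrable lborel g" "AE x in lborel. f x = g x"
    using lebesgue_integrable_borel_version[OF f] by metis
  have [measurable]: "g \<in> borel_measurable borel" by fact
  have "AE x in lborel. g x = 0"
  proof (rule AE_zero_if_box_integrals_zero[OF g(2)])
    fix c d :: 'a
    have "integrable lebesgue (\<lambda>x. indicator (box c d) x * f x)"
      using integrable_mult_indicator[OF _ f, of "box c d"] by simp
    moreover have "AE x in lborel. indicator (box c d) x * f x = indicator (box c d) x * g x"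
      using g(3) by eventually_elim simp
    ultimately have "(LINT x|lborel. indicator (box c d) x * g x) = (LINT x|lebesgue. indicator (box c d) x * f x)"
      by (intro integrable_lborel_cong_lebesgue(2)) auto
    then show "(LINT x|lborel. indicator (box c d) x * g x) = 0"
      using box[of c d] by simp
  qed
  with g(3) have "AE x in lborel. f x = 0" by eventually_elim simp
  then show ?thesis by (rule AE_completion)
qed

text \<open>
  Weighting by the slab \<open>0 \<le> y \<bullet> e \<le> 1\<close>, which every line in direction \<open>e\<close> meets in length \<open>1\<close>, gives
  Fubini for lines from translation invariance, without splitting off a coordinate of the space.
\<close>

lemma nn_integral_along_lines:
  fixes F :: "'a::euclidean_space \<Rightarrow> ennreal"
  assumes [measurable]: "F \<in> borel_measurable borel" and e: "e \<in> Basis"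
  shows "(\<integral>\<^sup>+x. F x \<partial>lborel) =
    (\<integral>\<^sup>+y. indicator {y. y \<bullet> e \<in> {0..1}} y * (\<integral>\<^sup>+s. F (y + s *\<^sub>R e) \<partial>lborel) \<partial>lborel)"
proof -
  let ?w = "indicator {y. y \<bullet> e \<in> {0..1}} :: 'a \<Rightarrow> ennreal"
  have [measurable]: "?w \<in> borel_measurable borel" by simp
  have inner: "(\<integral>\<^sup>+s. ?w (x - s *\<^sub>R e) \<partial>lborel) = 1" for x
  proof -
    have "?w (x - s *\<^sub>R e) = indicator {x \<bullet> e - 1..x \<bullet> e} s" for s
      using e by (auto simp: indicator_def inner_diff_left)
    then show ?thesis by simp
  qed
  have trans: "(\<integral>\<^sup>+y. ?w y * F (y + s *\<^sub>R e) \<partial>lborel) = (\<integral>\<^sup>+x. ?w (x - s *\<^sub>R e) * F x \<partial>lborel)" for s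
  proof -
    have "(\<integral>\<^sup>+x. ?w (x - s *\<^sub>R e) * F x \<partial>lborel)
        = (\<integral>\<^sup>+x. ?w (x - s *\<^sub>R e) * F x \<partial>distr lborel borel ((+) (s *\<^sub>R e)))"
      by (simp only: lborel_distr_plus)
    also have "\<dots> = (\<integral>\<^sup>+y. ?w y * F (y + s *\<^sub>R e) \<partial>lborel)"
      by (subst nn_integral_distr) (simp_all add: add.commute)
    finally show ?thesis by simp
  qed
  have "(\<integral>\<^sup>+y. ?w y * (\<integral>\<^sup>+s. F (y + s *\<^sub>R e) \<partial>lborel) \<partial>lborel)
      = (\<integral>\<^sup>+y. (\<integral>\<^sup>+s. ?w y * F (y + s *\<^sub>R e) \<partial>lborel) \<partial>lborel)"
    by (simp add: nn_integral_cmult)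
  also have "\<dots> = (\<integral>\<^sup>+s. (\<integral>\<^sup>+y. ?w y * F (y + s *\<^sub>R e) \<partial>lborel) \<partial>lborel)"
    by (rule lborel_pair.Fubini'[symmetric]) measurable
  also have "\<dots> = (\<integral>\<^sup>+s. (\<integral>\<^sup>+x. ?w (x - s *\<^sub>R e) * F x \<partial>lborel) \<partial>lborel)"
    by (simp only: trans)
  also have "\<dots> = (\<integral>\<^sup>+x. (\<integral>\<^sup>+s. ?w (x - s *\<^sub>R e) * F x \<partial>lborel) \<partial>lborel)"
    by (rule lborel_pair.Fubini'[symmetric]) measurable
  also have "\<dots> = (\<integral>\<^sup>+x. F x \<partial>lborel)"
    by (subst nn_integral_multc) (simp_all only: inner mult_1, measurable)
  finally show ?thesis by simp
qed

text \<open>The slab formula for the indicator of \<open>N\<close>. Base points outside the slab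
  have weight zero, hence the restriction; every line still has base points inside it.\<close>

lemma AE_lines_avoid_null_set:
  fixes N :: "'a::euclidean_space set"
  assumes N: "N \<in> null_sets lborel" and e: "e \<in> Basis"
  shows "AE y in lborel. y \<bullet> e \<in> {0..1} \<longrightarrow> (AE s in lborel. y + s *\<^sub>R e \<notin> N)"
proof -
  have [measurable]: "N \<in> sets borel" using N by auto
  have [measurable]: "{y::'a. y \<bullet> e \<in> {0..1}} \<in> sets borel" by simp
  have "(\<integral>\<^sup>+x. indicator N x \<partial>lborel) = 0" using N by auto
  then have "(\<integral>\<^sup>+y. indicator {y. y \<bullet> e \<in> {0..1}} y * (\<integral>\<^sup>+s. indicator N (y + s *\<^sub>R e) \<partial>lborel) \<partial>lborel) = 0"
    by (subst (asm) nn_integral_along_lines[OF _ e]) auto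
  then have "AE y in lborel. indicator {y. y \<bullet> e \<in> {0..1}} y * (\<integral>\<^sup>+s. indicator N (y + s *\<^sub>R e) \<partial>lborel) = (0::ennreal)"
    by (subst (asm) nn_integral_0_iff_AE) auto
  then show ?thesis
  proof eventually_elim
    case (elim y)
    show ?case
    proof
      assume "y \<bullet> e \<in> {0..1}"
      with elim have "(\<integral>\<^sup>+s. indicator N (y + s *\<^sub>R e) \<partial>lborel) = (0::ennreal)" by simp
      then have "AE s in lborel. indicator N (y + s *\<^sub>R e) = (0::ennreal)"
        by (subst (asm) nn_integral_0_iff_AE) auto
      then show "AE s in lborel. y + s *\<^sub>R e \<notin> N"
        by eventually_elim (auto simp: indicator_def split: if_splits)
    qed
  qed
qed

text \<open>The slab formula is available for nonnegative Borel functions only, so it is applied to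
  both parts of a Borel version \<open>G\<close>. \<open>G\<close> agrees with \<open>F\<close>
  along almost every line, and there the two parts have equal finite integrals.\<close>

lemma integral_zero_if_zero_along_lines:
  fixes F :: "'a::euclidean_space \<Rightarrow> real"
  assumes F: "integrable lebesgue F" and e: "e \<in> Basis"
    and line: "\<And>y. integrable lebesgue (\<lambda>s. F (y + s *\<^sub>R e))"
      "\<And>y. (LINT s|lebesgue. F (y + s *\<^sub>R e)) = 0"
  shows "integral\<^sup>L lebesgue F = 0"
proof -
  obtain G where G: "G \<in> borel_measurable borel" "integrable lborel G" "AE x in lborel. F x = G x"
    "integral\<^sup>L lborel G = integral\<^sup>L lebesgue F"
    using lebesgue_integrable_borel_version[OF F] by metis
  have [measurable]: "G \<in> borel_measurable borel" by fact
  obtain N where N: "N \<in> null_sets lborel" "{x. F x \<noteq> G x} \<subseteq> N"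
    using G(3) unfolding eventually_ae_filter by auto
  have ae: "AE y in lborel. y \<bullet> e \<in> {0..1} \<longrightarrow>
     (\<integral>\<^sup>+s. ennreal (G (y + s *\<^sub>R e)) \<partial>lborel) = (\<integral>\<^sup>+s. ennreal (- G (y + s *\<^sub>R e)) \<partial>lborel)"
    using AE_lines_avoid_null_set[OF N(1) e]
  proof eventually_elim
    case (elim y)
    show ?case
    proof
      assume "y \<bullet> e \<in> {0..1}"
      with elim have "AE s in lborel. y + s *\<^sub>R e \<notin> N" by blast
      then have "AE s in lborel. F (y + s *\<^sub>R e) = G (y + s *\<^sub>R e)"
        by eventually_elim (use N(2) in auto)
      then have g: "integrable lborel (\<lambda>s. G (y + s *\<^sub>R e))" "(LINT s|lborel. G (y + s *\<^sub>R e)) = 0"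
        using integrable_lborel_cong_lebesgue[OF line(1)[of y], of "\<lambda>s. G (y + s *\<^sub>R e)"] line(2)[of y]
        by auto
      have "(\<integral>\<^sup>+s. ennreal (G (y + s *\<^sub>R e)) \<partial>lborel) \<noteq> \<infinity>" "(\<integral>\<^sup>+s. ennreal (- G (y + s *\<^sub>R e)) \<partial>lborel) \<noteq> \<infinity>"
        using g(1) unfolding real_integrable_def by auto
      moreover have "enn2real (\<integral>\<^sup>+s. ennreal (G (y + s *\<^sub>R e)) \<partial>lborel) = enn2real (\<integral>\<^sup>+s. ennreal (- G (y + s *\<^sub>R e)) \<partial>lborel)"
        using real_lebesgue_integral_def[OF g(1)] g(2) by simp
      ultimately show "(\<integral>\<^sup>+s. ennreal (G (y + s *\<^sub>R e)) \<partial>lborel) = (\<integral>\<^sup>+s. ennreal (- G (y + s *\<^sub>R e)) \<partial>lborel)"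
        by (intro enn2real_inj_finite) auto
    qed
  qed
  have "(\<integral>\<^sup>+x. ennreal (G x) \<partial>lborel) = (\<integral>\<^sup>+x. ennreal (- G x) \<partial>lborel)"
    by (subst (1 2) nn_integral_along_lines[OF _ e])
      (auto intro!: nn_integral_cong_AE eventually_mono[OF ae])
  then show ?thesis using real_lebesgue_integral_def[OF G(2)] G(4) by simp
qed

text \<open>Up to a null set, \<open>N\<close> is a Borel set \<open>S\<close>, and Tonelli along
  lines makes \<open>S\<close> null. Measurability of \<open>N\<close> is essential: a set meeting
  every line in at most two points need not be measurable, let alone null.\<close>

lemma AE_if_AE_along_lines:
  fixes N :: "'a::euclidean_space set"
  assumes N: "N \<in> sets lebesgue" and e: "e \<in> Basis"
    and line: "\<And>y. AE s in lebesgue. y + s *\<^sub>R e \<notin> N"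
  shows "AE x in lebesgue. x \<notin> N"
proof -
  obtain S N' N'' where S: "N = S \<union> N''" "N'' \<subseteq> N'" "N' \<in> null_sets lborel" "S \<in> sets lborel"
    using N by (elim sets_completionE) auto
  have [measurable]: "S \<in> sets borel" using S by auto
  have [measurable]: "{y::'a. y \<bullet> e \<in> {0..1}} \<in> sets borel" by simp
  have "(\<integral>\<^sup>+s. indicator S (y + s *\<^sub>R e) \<partial>lborel) = (0::ennreal)" for y
  proof -
    have "AE s in lborel. y + s *\<^sub>R e \<notin> S"
      using line[of y] by (subst (asm) AE_completion_iff) (auto simp: S elim: eventually_mono)
    then show ?thesis
      by (subst nn_integral_0_iff_AE) (auto elim: eventually_mono)
  qed
  then have "(\<integral>\<^sup>+x. indicator S x \<partial>lborel) = (0::ennreal)"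
    by (subst nn_integral_along_lines[OF _ e]) auto
  then have "S \<in> null_sets lborel" using S(4) by (auto simp: null_sets_def)
  then have "AE x in lborel. x \<notin> S \<union> N'"
    using S(3) by (intro AE_not_in) auto
  then have "AE x in lborel. x \<notin> N"
    by eventually_elim (use S in auto)
  then show ?thesis by (rule AE_completion)
qed

text \<open>If every section of the kernel has mass at most \<open>C\<close>, then the absolute
  integral of \<open>f x * k (x, y)\<close> over the product is at most \<open>C\<close> times that
  of \<open>f\<close>, and Fubini applies. The mass bound is required only where \<open>f\<close> is
  nonzero, since the mass of the Abel kernels used later grows with the distance to a cutoff and is
  controlled only on the support of \<open>f\<close>.\<close>

lemma kernel_swap:
  fixes f :: "'a::euclidean_space \<Rightarrow> real" and k :: "'a \<times> 'b::euclidean_space \<Rightarrow> real"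
  assumes f: "integrable lborel f" and [measurable]: "k \<in> borel_measurable borel"
    and C: "\<And>x. f x \<noteq> 0 \<Longrightarrow> (\<integral>\<^sup>+y. ennreal \<bar>k (x, y)\<bar> \<partial>lborel) \<le> ennreal C"
  shows "integrable lborel (\<lambda>x. LINT y|lborel. f x * k (x, y))"
    and "integrable lborel (\<lambda>y. LINT x|lborel. f x * k (x, y))"
    and "(LINT y|lborel. LINT x|lborel. f x * k (x, y)) = (LINT x|lborel. LINT y|lborel. f x * k (x, y))"
proof -
  have [measurable]: "f \<in> borel_measurable borel" using f by auto
  have [measurable]: "k \<in> borel_measurable (borel \<Otimes>\<^sub>M borel)" by (simp add: borel_prod)
  have int: "integrable (lborel \<Otimes>\<^sub>M lborel) (case_prod (\<lambda>x y. f x * k (x, y)))"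
  proof (rule integrableI_bounded)
    show "case_prod (\<lambda>x y. f x * k (x, y)) \<in> borel_measurable (lborel \<Otimes>\<^sub>M lborel)" by measurable
    have "(\<integral>\<^sup>+z. ennreal (norm (case z of (x, y) \<Rightarrow> f x * k (x, y))) \<partial>(lborel \<Otimes>\<^sub>M lborel))
      = (\<integral>\<^sup>+x. \<integral>\<^sup>+y. ennreal \<bar>f x\<bar> * ennreal \<bar>k (x, y)\<bar> \<partial>lborel \<partial>lborel)"
      by (subst lborel.nn_integral_fst[symmetric]) (auto simp: abs_mult ennreal_mult)
    also have "\<dots> = (\<integral>\<^sup>+x. ennreal \<bar>f x\<bar> * (\<integral>\<^sup>+y. ennreal \<bar>k (x, y)\<bar> \<partial>lborel) \<partial>lborel)"
      by (subst nn_integral_cmult) auto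
    also have "\<dots> \<le> (\<integral>\<^sup>+x. ennreal \<bar>f x\<bar> * ennreal C \<partial>lborel)"
    proof (intro nn_integral_mono)
      fix x
      show "ennreal \<bar>f x\<bar> * (\<integral>\<^sup>+y. ennreal \<bar>k (x, y)\<bar> \<partial>lborel) \<le> ennreal \<bar>f x\<bar> * ennreal C"
        by (cases "f x = 0") (auto intro!: mult_left_mono C)
    qed
    also have "\<dots> = (\<integral>\<^sup>+x. ennreal \<bar>f x\<bar> \<partial>lborel) * ennreal C"
      by (rule nn_integral_multc) auto
    also have "\<dots> < \<infinity>"
      using f unfolding integrable_iff_bounded by (auto simp: ennreal_mult_less_top)
    finally show "(\<integral>\<^sup>+z. ennreal (norm (case z of (x, y) \<Rightarrow> f x * k (x, y))) \<partial>(lborel \<Otimes>\<^sub>M lborel)) < \<infinity>" .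
  qed
  show "integrable lborel (\<lambda>x. LINT y|lborel. f x * k (x, y))"
    using lborel_pair.integrable_fst'[OF int] by simp
  show "integrable lborel (\<lambda>y. LINT x|lborel. f x * k (x, y))"
    using lborel_pair.integrable_snd[OF int] by simp
  show "(LINT y|lborel. LINT x|lborel. f x * k (x, y)) = (LINT x|lborel. LINT y|lborel. f x * k (x, y))"
    using lborel_pair.Fubini_integral[OF int] by simp
qed

section \<open>The Abel kernel\<close>

text \<open>Dominated convergence for difference quotients. The exceptional null set of the
  Lipschitz bound may depend on \<open>t\<close>, which is harmless because the limit is tested
  along sequences.\<close>

lemma has_real_derivative_under_integral:
  fixes f :: "real \<Rightarrow> 'a \<Rightarrow> real"
  assumes S: "open S" "t0 \<in> S"
    and f: "\<And>t. t \<in> S \<Longrightarrow> integrable M (f t)"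
    and f': "AE x in M. ((\<lambda>t. f t x) has_real_derivative f' x) (at t0)" "f' \<in> borel_measurable M"
    and w: "integrable M w" "\<And>t. t \<in> S \<Longrightarrow> AE x in M. \<bar>f t x - f t0 x\<bar> \<le> w x * \<bar>t - t0\<bar>"
  shows "((\<lambda>t. LINT x|M. f t x) has_real_derivative (LINT x|M. f' x)) (at t0)"
proof -
  have "((\<lambda>t. ((LINT x|M. f t x) - (LINT x|M. f t0 x)) / (t - t0)) \<longlongrightarrow> (LINT x|M. f' x)) (at t0 within S)"
    unfolding tendsto_at_iff_sequentially
  proof (intro allI impI)
    fix X :: "nat \<Rightarrow> real" assume X: "\<forall>i. X i \<in> S - {t0}" "X \<longlonglongrightarrow> t0"
    let ?q = "\<lambda>i x. (f (X i) x - f t0 x) / (X i - t0)"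
    have "(\<lambda>i. LINT x|M. ?q i x) \<longlonglongrightarrow> (LINT x|M. f' x)"
    proof (rule integral_dominated_convergence[where w = w])
      show "?q i \<in> borel_measurable M" for i
        using f[of "X i"] f[OF S(2)] X by auto
      show "AE x in M. (\<lambda>i. ?q i x) \<longlonglongrightarrow> f' x"
        using f'(1)
      proof eventually_elim
        case (elim x)
        then have "((\<lambda>t. (f t x - f t0 x) / (t - t0)) \<longlongrightarrow> f' x) (at t0)"
          by (simp add: has_field_derivative_iff)
        then show ?case
          using X unfolding tendsto_at_iff_sequentially by (auto simp: o_def)
      qed
      show "AE x in M. norm (?q i x) \<le> w x" for i
      proof -
        have "X i \<in> S" "X i \<noteq> t0" using X by auto
        show ?thesis
          using w(2)[OF \<open>X i \<in> S\<close>] by eventually_elim (use \<open>X i \<noteq> t0\<close> in \<open>simp add: divide_le_eq\<close>)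
      qed
    qed (use f' w in auto)
    moreover have "(LINT x|M. ?q i x) = ((LINT x|M. f (X i) x) - (LINT x|M. f t0 x)) / (X i - t0)" for i
    proof -
      have "X i \<in> S" using X by auto
      then show ?thesis using f[of "X i"] f[OF S(2)] by (simp only: integral_divide_zero Bochner_Integration.integral_diff)
    qed
    ultimately show "((\<lambda>t. ((LINT x|M. f t x) - (LINT x|M. f t0 x)) / (t - t0)) \<circ> X) \<longlonglongrightarrow> (LINT x|M. f' x)"
      by (simp only: o_def)
  qed
  then show ?thesis
    unfolding has_field_derivative_iff at_within_open[OF S(2,1)] .
qed

lemma has_bochner_integral_if_has_integral_nonneg:
  fixes f :: "real \<Rightarrow> real"
  assumes "f \<in> borel_measurable borel" "\<And>x. 0 \<le> f x" "(f has_integral I) UNIV"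
  shows "has_bochner_integral lborel f I"
proof -
  have "0 \<le> I" using assms by (intro has_integral_nonneg[OF assms(3)]) auto
  then show ?thesis
    using nn_integral_has_integral_lborel[OF assms] assms
    by (intro has_bochner_integral_nn_integral) auto
qed

text \<open>Cutting the power off at zero turns integrals over \<open>{a..t}\<close> into
  convolutions over the whole line, so that Fubini and translations need no bookkeeping of
  limits.\<close>

definition abel_kernel :: "real \<Rightarrow> real \<Rightarrow> real" where
  "abel_kernel \<beta> r = (if 0 < r then r powr (- \<beta>) else 0)"

lemma abel_kernel_nonneg [simp]: "0 \<le> abel_kernel \<beta> r"
  by (simp add: abel_kernel_def)

lemma borel_measurable_abel_kernel [measurable]: "abel_kernel \<beta> \<in> borel_measurable borel"
  unfolding abel_kernel_def[abs_def] by measurable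

lemma has_bochner_integral_abel_kernel:
  assumes "\<beta> < 1"
  shows "has_bochner_integral lborel (\<lambda>r. indicator {..c} r * abel_kernel \<beta> r) (max 0 c powr (1 - \<beta>) / (1 - \<beta>))"
proof (rule has_bochner_integral_if_has_integral_nonneg)
  have "((\<lambda>r. r powr (- \<beta>)) has_integral (max 0 c powr (- \<beta> + 1) / (- \<beta> + 1))) {0..max 0 c}"
    using assms by (intro has_integral_powr_from_0) auto
  then have "((\<lambda>r. if r \<in> {0..max 0 c} then r powr (- \<beta>) else 0) has_integral (max 0 c powr (1 - \<beta>) / (1 - \<beta>))) UNIV"
    by (subst has_integral_restrict_UNIV) simp
  moreover have "(\<lambda>r. if r \<in> {0..max 0 c} then r powr (- \<beta>) else 0) = (\<lambda>r. indicator {..c} r * abel_kernel \<beta> r)"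
    by (auto simp: fun_eq_iff abel_kernel_def indicator_def max_def)
  ultimately show "((\<lambda>r. indicator {..c} r * abel_kernel \<beta> r) has_integral (max 0 c powr (1 - \<beta>) / (1 - \<beta>))) UNIV"
    by simp
qed auto

lemma has_bochner_integral_abel_kernel_shift:
  assumes "\<beta> < 1"
  shows "has_bochner_integral lborel (\<lambda>t. indicator {..\<tau>} t * abel_kernel \<beta> (t - s)) (max 0 (\<tau> - s) powr (1 - \<beta>) / (1 - \<beta>))"
proof -
  have "(\<lambda>t. indicator {..\<tau>} t * abel_kernel \<beta> (t - s)) = (\<lambda>t. indicator {..\<tau> - s} (- s + 1 * t) * abel_kernel \<beta> (- s + 1 * t))"
    by (auto simp: fun_eq_iff indicator_def)
  then show ?thesis
    using has_bochner_integral_abel_kernel[OF assms, of "\<tau> - s"]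
    by (subst (asm) lborel_has_bochner_integral_real_affine_iff[where c = 1 and t = "- s"]) auto
qed

lemma has_bochner_integral_abel_kernel_reflect:
  assumes "\<beta> < 1"
  shows "has_bochner_integral lborel (\<lambda>t. indicator {s..} t * abel_kernel \<beta> (\<tau> - t)) (max 0 (\<tau> - s) powr (1 - \<beta>) / (1 - \<beta>))"
proof -
  have "(\<lambda>t. indicator {s..} t * abel_kernel \<beta> (\<tau> - t)) = (\<lambda>t. indicator {..\<tau> - s} (\<tau> + (-1) * t) * abel_kernel \<beta> (\<tau> + (-1) * t))"
    by (auto simp: fun_eq_iff indicator_def)
  then show ?thesis
    using has_bochner_integral_abel_kernel[OF assms, of "\<tau> - s"]
    by (subst (asm) lborel_has_bochner_integral_real_affine_iff[where c = "-1" and t = "\<tau>"]) auto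
qed

text \<open>The substitution t = s + (\<tau> - s) \<theta> produces the Beta integral. The powers of
  \<tau> - s cancel, as the exponents \<beta> - 1, -\<beta> and 1 (from the Jacobian) add up to
  zero. That the value does not depend on \<open>s\<close> and \<open>\<tau>\<close> is what makes
  Abel's equation solvable: composing both kernels is plain integration up to a constant.\<close>

lemma has_bochner_integral_abel_kernel_product:
  assumes \<beta>: "0 < \<beta>" "\<beta> < 1"
  shows "has_bochner_integral lborel (\<lambda>t. abel_kernel (1 - \<beta>) (\<tau> - t) * abel_kernel \<beta> (t - s))
    (if s < \<tau> then Beta (1 - \<beta>) \<beta> else 0)"
proof (cases "s < \<tau>")
  case True
  let ?F = "\<lambda>\<theta>. indicator {0<..<1} \<theta> * (\<theta> powr (- \<beta>) * (1 - \<theta>) powr (\<beta> - 1)) :: real"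
  have "((\<lambda>t. t powr ((1 - \<beta>) - 1) * (1 - t) powr (\<beta> - 1)) has_integral Beta (1 - \<beta>) \<beta>) {0..1}"
    using \<beta> by (intro has_integral_Beta_real) auto
  then have "((\<lambda>t. if t \<in> {0<..<1} then t powr (- \<beta>) * (1 - t) powr (\<beta> - 1) else 0) has_integral Beta (1 - \<beta>) \<beta>) UNIV"
    by (subst has_integral_restrict_UNIV) (simp add: has_integral_Icc_iff_Ioo)
  moreover have "(\<lambda>t. if t \<in> {0<..<1} then t powr (- \<beta>) * (1 - t) powr (\<beta> - 1) else 0) = ?F"
    by (auto simp: fun_eq_iff)
  ultimately have "has_bochner_integral lborel ?F (Beta (1 - \<beta>) \<beta>)"
    by (intro has_bochner_integral_if_has_integral_nonneg) auto
  then have 1: "has_bochner_integral lborel (\<lambda>\<theta>. ?F \<theta> / (\<tau> - s)) (Beta (1 - \<beta>) \<beta> / (\<tau> - s))"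
    by (rule has_bochner_integral_divide_zero)
  have 2: "?F \<theta> / (\<tau> - s) = abel_kernel (1 - \<beta>) (\<tau> - (s + (\<tau> - s) * \<theta>)) * abel_kernel \<beta> (s + (\<tau> - s) * \<theta> - s)" for \<theta>
  proof -
    have e: "\<tau> - (s + (\<tau> - s) * \<theta>) = (\<tau> - s) * (1 - \<theta>)" "s + (\<tau> - s) * \<theta> - s = (\<tau> - s) * \<theta>"
      by (auto simp: algebra_simps)
    show ?thesis
    proof (cases "0 < \<theta> \<and> \<theta> < 1")
      case th: True
      have "(\<tau> - s) powr (\<beta> - 1) * (\<tau> - s) powr (- \<beta>) = 1 / (\<tau> - s)"
        using True powr_minus_divide[of "\<tau> - s" 1] by (simp add: powr_add[symmetric] del: powr_minus)
      then have "(\<tau> - s) powr (\<beta> - 1) * (1 - \<theta>) powr (\<beta> - 1) * ((\<tau> - s) powr (- \<beta>) * \<theta> powr (- \<beta>))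
          = (\<theta> powr (- \<beta>) * (1 - \<theta>) powr (\<beta> - 1)) * (1 / (\<tau> - s))"
        by (metis (no_types, lifting) mult.assoc mult.commute mult.left_commute)
      then show ?thesis
        unfolding e using th True by (simp add: abel_kernel_def powr_mult)
    next
      case False
      then show ?thesis
        unfolding e using True by (auto simp: abel_kernel_def zero_less_mult_iff)
    qed
  qed
  have "has_bochner_integral lborel (\<lambda>\<theta>. abel_kernel (1 - \<beta>) (\<tau> - (s + (\<tau> - s) * \<theta>)) * abel_kernel \<beta> (s + (\<tau> - s) * \<theta> - s))
     (Beta (1 - \<beta>) \<beta> /\<^sub>R \<bar>\<tau> - s\<bar>)"
    unfolding 2[symmetric] using 1 True by (simp add: divide_inverse mult.commute)
  then show ?thesis
    using True by (subst lborel_has_bochner_integral_real_affine_iff[where c = "\<tau> - s" and t = s]) auto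
next
  case False
  then have "(\<lambda>t. abel_kernel (1 - \<beta>) (\<tau> - t) * abel_kernel \<beta> (t - s)) = (\<lambda>t. 0)"
    by (auto simp: fun_eq_iff abel_kernel_def)
  then show ?thesis using False by (simp add: has_bochner_integral_zero)
qed

text \<open>Gamma(1 - \<beta>) times the fractional integral of order 1 - \<beta> with lower limit
  minus infinity. For a function vanishing up to some \<open>c\<close> every lower limit below
  \<open>c\<close> gives the same value.\<close>

definition abel_transform :: "real \<Rightarrow> (real \<Rightarrow> real) \<Rightarrow> real \<Rightarrow> real" where
  "abel_transform \<beta> g t = (LINT s|lborel. abel_kernel \<beta> (t - s) * g s)"

text \<open>Substituting s = t - r moves \<open>t\<close> out of the singular kernel and into
  \<open>g\<close>, so regularity in \<open>t\<close> can be read off from \<open>g\<close>. The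
  cutoff at \<open>B\<close> is needed because the kernel is integrable near zero but in general not
  at infinity; it loses nothing as \<open>g (t - r)\<close> vanishes for larger \<open>r\<close>,
  and one \<open>B\<close> serves all \<open>t \<le> B + c\<close>.\<close>

lemma
  fixes g :: "real \<Rightarrow> real"
  assumes \<beta>: "\<beta> < 1" and g: "continuous_on UNIV g" "\<And>x. \<bar>g x\<bar> \<le> M" "\<And>x. x \<le> c \<Longrightarrow> g x = 0"
    and t: "t - c \<le> B"
  shows abel_transform_integrable: "integrable lborel (\<lambda>s. abel_kernel \<beta> (t - s) * g s)"
    and abel_transform_shift_integrable: "integrable lborel (\<lambda>r. indicator {..B} r * abel_kernel \<beta> r * g (t - r))"
    and abel_transform_shift: "abel_transform \<beta> g t = (LINT r|lborel. indicator {..B} r * abel_kernel \<beta> r * g (t - r))"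
proof -
  have [measurable]: "g \<in> borel_measurable borel" using g(1) by (rule borel_measurable_continuous_onI)
  have 0: "integrable lborel (\<lambda>r. indicator {..B} r * abel_kernel \<beta> r)"
    using has_bochner_integral_abel_kernel[OF \<beta>, of B] by (simp add: has_bochner_integral_iff)
  show 1: "integrable lborel (\<lambda>r. indicator {..B} r * abel_kernel \<beta> r * g (t - r))"
  proof (rule Bochner_Integration.integrable_bound)
    show "integrable lborel (\<lambda>r. indicator {..B} r * abel_kernel \<beta> r * M)" using 0 by simp
    have "\<bar>indicator {..B} r * abel_kernel \<beta> r * g (t - r)\<bar> \<le> \<bar>indicator {..B} r * abel_kernel \<beta> r * M\<bar>" for r
    proof -
      have "\<bar>g (t - r)\<bar> \<le> \<bar>M\<bar>" using g(2)[of "t - r"] by linarith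
      then show ?thesis unfolding abs_mult by (intro mult_left_mono) auto
    qed
    then show "AE r in lborel. norm (indicator {..B} r * abel_kernel \<beta> r * g (t - r)) \<le> norm (indicator {..B} r * abel_kernel \<beta> r * M)"
      by simp
  qed auto
  have eq: "(\<lambda>r. indicator {..B} r * abel_kernel \<beta> r * g (t - r)) = (\<lambda>r. abel_kernel \<beta> (t - (t + (-1) * r)) * g (t + (-1) * r))"
  proof
    fix r
    show "indicator {..B} r * abel_kernel \<beta> r * g (t - r) = abel_kernel \<beta> (t - (t + (-1) * r)) * g (t + (-1) * r)"
      using g(3)[of "t - r"] t by (cases "r \<le> B") auto
  qed
  have "has_bochner_integral lborel (\<lambda>r. abel_kernel \<beta> (t - (t + (-1) * r)) * g (t + (-1) * r))
     ((LINT r|lborel. indicator {..B} r * abel_kernel \<beta> r * g (t - r)) /\<^sub>R \<bar>-1\<bar>)"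
    using 1 unfolding has_bochner_integral_iff eq[symmetric] by simp
  then have 2: "has_bochner_integral lborel (\<lambda>s. abel_kernel \<beta> (t - s) * g s)
     (LINT r|lborel. indicator {..B} r * abel_kernel \<beta> r * g (t - r))"
    by (subst lborel_has_bochner_integral_real_affine_iff[where c = "-1" and t = t]) auto
  then show "integrable lborel (\<lambda>s. abel_kernel \<beta> (t - s) * g s)"
    "abel_transform \<beta> g t = (LINT r|lborel. indicator {..B} r * abel_kernel \<beta> r * g (t - r))"
    by (simp_all add: has_bochner_integral_iff abel_transform_def)
qed

lemma abel_transform_eq_0:
  assumes "\<And>x. x \<le> c \<Longrightarrow> g x = 0" "t \<le> c"
  shows "abel_transform \<beta> g t = 0"
proof -
  have "(\<lambda>s. abel_kernel \<beta> (t - s) * g s) = (\<lambda>s. 0)"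
    using assms by (auto simp: fun_eq_iff abel_kernel_def)
  then show ?thesis by (simp add: abel_transform_def)
qed

lemma continuous_on_abel_transform:
  fixes g :: "real \<Rightarrow> real"
  assumes \<beta>: "\<beta> < 1" and g: "continuous_on UNIV g" "\<And>x. \<bar>g x\<bar> \<le> M" "\<And>x. x \<le> c \<Longrightarrow> g x = 0"
  shows "continuous_on {..T} (abel_transform \<beta> g)"
  unfolding continuous_on_sequentially
proof (intro allI ballI impI, elim conjE)
  fix X :: "nat \<Rightarrow> real" and t assume t: "t \<in> {..T}" and X: "\<forall>n. X n \<in> {..T}" "X \<longlonglongrightarrow> t"
  have [measurable]: "g \<in> borel_measurable borel" using g(1) by (rule borel_measurable_continuous_onI)
  let ?w = "\<lambda>r. indicator {..T - c} r * abel_kernel \<beta> r :: real"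
  have eq: "abel_transform \<beta> g s = (LINT r|lborel. ?w r * g (s - r))" if "s \<le> T" for s
    using that by (intro abel_transform_shift[OF \<beta> g]) auto
  have "(\<lambda>n. LINT r|lborel. ?w r * g (X n - r)) \<longlonglongrightarrow> (LINT r|lborel. ?w r * g (t - r))"
  proof (rule integral_dominated_convergence[where w = "\<lambda>r. ?w r * \<bar>M\<bar>"])
    show "integrable lborel (\<lambda>r. ?w r * \<bar>M\<bar>)"
      using has_bochner_integral_abel_kernel[OF \<beta>, of "T - c"] by (simp add: has_bochner_integral_iff)
    show "AE r in lborel. (\<lambda>n. ?w r * g (X n - r)) \<longlonglongrightarrow> ?w r * g (t - r)"
    proof (intro AE_I2 tendsto_mult_left)
      fix r
      have "isCont g (t - r)" using g(1) by (simp add: continuous_on_eq_continuous_at)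
      then show "(\<lambda>n. g (X n - r)) \<longlonglongrightarrow> g (t - r)"
        by (rule isCont_tendsto_compose) (intro tendsto_diff X tendsto_const)
    qed
    show "AE r in lborel. norm (?w r * g (X n - r)) \<le> ?w r * \<bar>M\<bar>" for n
    proof (intro AE_I2)
      fix r
      have "\<bar>g (X n - r)\<bar> \<le> \<bar>M\<bar>" using g(2)[of "X n - r"] by linarith
      then show "norm (?w r * g (X n - r)) \<le> ?w r * \<bar>M\<bar>"
        by (simp add: abs_mult mult_left_mono)
    qed
  qed auto
  then show "(abel_transform \<beta> g \<circ> X) \<longlonglongrightarrow> abel_transform \<beta> g t"
    using X t by (simp add: o_def eq)
qed

text \<open>As \<open>h\<close> vanishes on the left, differentiating produces no boundary term and
  the derivative falls on \<open>h\<close> alone: for such functions the Riemann--Liouville and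
  Caputo derivatives coincide.\<close>

lemma has_real_derivative_abel_transform:
  fixes h h' :: "real \<Rightarrow> real"
  assumes \<beta>: "\<beta> < 1" and h: "\<And>x. (h has_real_derivative h' x) (at x)" "\<And>x. \<bar>h x\<bar> \<le> M" "\<And>x. x \<le> c \<Longrightarrow> h x = 0"
    and h': "continuous_on UNIV h'" "\<And>x. \<bar>h' x\<bar> \<le> M'" "\<And>x. x \<le> c \<Longrightarrow> h' x = 0"
  shows "(abel_transform \<beta> h has_real_derivative abel_transform \<beta> h' t) (at t)"
proof -
  have cont: "continuous_on UNIV h"
    using h(1) by (meson DERIV_isCont continuous_at_imp_continuous_on)
  have [measurable]: "h \<in> borel_measurable borel" "h' \<in> borel_measurable borel"
    using cont h'(1) by (auto intro: borel_measurable_continuous_onI)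
  \<comment> \<open>The extra 1 makes the same cutoff valid for all points in a neighbourhood of
    \<open>t\<close>.\<close>
  let ?w = "\<lambda>r. indicator {..t + 1 - c} r * abel_kernel \<beta> r :: real"
  have eq: "abel_transform \<beta> h s = (LINT r|lborel. ?w r * h (s - r))" if "s < t + 1" for s
    using that by (intro abel_transform_shift[OF \<beta> cont h(2,3)]) auto
  have eq': "abel_transform \<beta> h' t = (LINT r|lborel. ?w r * h' (t - r))"
    by (intro abel_transform_shift[OF \<beta> h']) auto
  have lip: "\<bar>h x - h y\<bar> \<le> M' * \<bar>x - y\<bar>" for x y
    using field_differentiable_bound[of UNIV h h' M' x y] h(1) h'(2) by auto
  have "((\<lambda>s. LINT r|lborel. ?w r * h (s - r)) has_real_derivative (LINT r|lborel. ?w r * h' (t - r))) (at t)"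
  proof (rule has_real_derivative_under_integral[where S = "{..<t + 1}" and w = "\<lambda>r. ?w r * M'"])
    show "integrable lborel (\<lambda>r. ?w r * h (s - r))" if "s \<in> {..<t + 1}" for s
      using that by (intro abel_transform_shift_integrable[OF \<beta> cont h(2,3)]) auto
    show "integrable lborel (\<lambda>r. ?w r * M')"
      using has_bochner_integral_abel_kernel[OF \<beta>, of "t + 1 - c"] by (simp add: has_bochner_integral_iff)
    show "AE r in lborel. ((\<lambda>s. ?w r * h (s - r)) has_real_derivative ?w r * h' (t - r)) (at t)"
    proof (intro AE_I2 DERIV_cmult)
      fix r
      show "((\<lambda>s. h (s - r)) has_real_derivative h' (t - r)) (at t)"
        using DERIV_shift[of h "h' (t - r)" t "- r"] h(1)[of "t - r"] by simp
    qed
    show "AE r in lborel. \<bar>?w r * h (s - r) - ?w r * h (t - r)\<bar> \<le> ?w r * M' * \<bar>s - t\<bar>" for s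
    proof (intro AE_I2)
      fix r
      have "\<bar>?w r * h (s - r) - ?w r * h (t - r)\<bar> = ?w r * \<bar>h (s - r) - h (t - r)\<bar>"
        by (simp add: right_diff_distrib[symmetric] abs_mult)
      also have "\<dots> \<le> ?w r * (M' * \<bar>(s - r) - (t - r)\<bar>)"
        by (intro mult_left_mono lip) auto
      finally show "\<bar>?w r * h (s - r) - ?w r * h (t - r)\<bar> \<le> ?w r * M' * \<bar>s - t\<bar>"
        by (simp add: mult.assoc)
    qed
  qed auto
  then show ?thesis
    unfolding eq'
    by (rule has_field_derivative_transform_within[where d = 1]) (auto simp: eq dist_real_def)
qed

lemma
  fixes g :: "real \<Rightarrow> real"
  assumes \<beta>: "\<beta> < 1" and g: "continuous_on UNIV g" "\<And>x. \<bar>g x\<bar> \<le> M" "\<And>x. x \<le> c \<Longrightarrow> g x = 0"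
    and a: "a \<le> c"
  shows abel_transform_absolutely_integrable: "(\<lambda>s. (t - s) powr (- \<beta>) * g s) absolutely_integrable_on {a..t}"
    and abel_transform_eq_integral: "integral {a..t} (\<lambda>s. (t - s) powr (- \<beta>) * g s) = abel_transform \<beta> g t"
proof -
  have [measurable]: "g \<in> borel_measurable borel" using g(1) by (rule borel_measurable_continuous_onI)
  have eq: "(\<lambda>s. indicator {a..t} s *\<^sub>R ((t - s) powr (- \<beta>) * g s)) = (\<lambda>s. abel_kernel \<beta> (t - s) * g s)"
    using g(3) a by (auto simp: fun_eq_iff indicator_def abel_kernel_def)
  have 1: "integrable lborel (\<lambda>s. abel_kernel \<beta> (t - s) * g s)"
    by (rule abel_transform_integrable[OF \<beta> g order_refl])
  show 2: "(\<lambda>s. (t - s) powr (- \<beta>) * g s) absolutely_integrable_on {a..t}"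
    unfolding set_integrable_def eq using 1 by (rule integrable_lebesgue_of_lborel)
  have "(LINT s:{a..t}|lebesgue. (t - s) powr (- \<beta>) * g s) = abel_transform \<beta> g t"
    unfolding set_lebesgue_integral_def eq abel_transform_def by (rule integral_completion) measurable
  then show "integral {a..t} (\<lambda>s. (t - s) powr (- \<beta>) * g s) = abel_transform \<beta> g t"
    using set_lebesgue_integral_eq_integral(2)[OF 2] by simp
qed

text \<open>Fubini moves the Abel kernel from \<open>h'\<close> to \<open>p\<close> and turns the
  left side into the integral of \<open>h'\<close> times \<open>R\<close>, the unnormalised right
  fractional integral of \<open>p\<close>. An ordinary integration by parts on \<open>{c..d}\<close>
  follows, without boundary terms since \<open>h\<close> vanishes at both ends. Because the support
  is strictly inside, \<open>R\<close> is only needed where it is known to be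
  differentiable.\<close>

lemma fractional_integration_by_parts:
  fixes h h' p q :: "real \<Rightarrow> real"
  assumes \<beta>: "0 < \<beta>" "\<beta> < 1" and ac: "a < c" "c \<le> d" "d < b"
    and h: "\<And>x. (h has_real_derivative h' x) (at x)" "\<And>x. x \<notin> {c<..<d} \<Longrightarrow> h x = 0"
    and h': "continuous_on UNIV h'" "\<And>x. \<bar>h' x\<bar> \<le> M" "\<And>x. x \<notin> {c<..<d} \<Longrightarrow> h' x = 0"
    and p: "\<And>t. t \<in> {a<..<b} \<Longrightarrow> (\<lambda>s. (s - t) powr (- \<beta>) * p s) absolutely_integrable_on {t..b}"
    and q: "\<And>t. t \<in> {a<..<b} \<Longrightarrow>
        ((\<lambda>t. integral {t..b} (\<lambda>s. (s - t) powr (- \<beta>) * p s)) has_real_derivative q t) (at t)"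
      "continuous_on {a<..<b} q"
  shows "integrable lebesgue (\<lambda>x. indicator {a<..<b} x * (p x * abel_transform \<beta> h' x))"
    and "integrable lebesgue (\<lambda>x. indicator {a<..<b} x * (h x * q x))"
    and "(LINT x|lebesgue. indicator {a<..<b} x * (p x * abel_transform \<beta> h' x)) =
       - (LINT x|lebesgue. indicator {a<..<b} x * (h x * q x))"
proof -
  define R where "R t = integral {t..b} (\<lambda>s. (s - t) powr (- \<beta>) * p s)" for t
  have [measurable]: "h' \<in> borel_measurable borel" using h'(1) by (rule borel_measurable_continuous_onI)
  have h'0: "\<And>x. x \<le> c \<Longrightarrow> h' x = 0" using h'(3) by auto
  have M0: "0 \<le> M" using h'(2)[of 0] by linarith
  \<comment> \<open>Any point strictly between \<open>a\<close> and \<open>c\<close> would do: the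
    weight with pole \<open>t0\<close> is continuous and positive on \<open>{c..b}\<close>, so it
    can be divided out and \<open>p\<close> itself is integrable there.\<close>
  define t0 where "t0 = (a + c) / 2"
  have t0: "a < t0" "t0 < c" using ac by (auto simp: t0_def)
  have pint: "p absolutely_integrable_on {c..b}"
  proof -
    have "(\<lambda>s. (s - t0) powr (- \<beta>) * p s) absolutely_integrable_on {c..b}"
      by (rule absolutely_integrable_on_subinterval[OF p[of t0]]) (use t0 ac in auto)
    then have "(\<lambda>s. (s - t0) powr \<beta> * ((s - t0) powr (- \<beta>) * p s)) absolutely_integrable_on {c..b}"
    proof (rule absolutely_integrable_bounded_measurable_product_real[rotated 3])
      have "continuous_on {c..b} (\<lambda>s. (s - t0) powr \<beta>)"
        using t0 by (intro continuous_intros) auto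
      then show "(\<lambda>s. (s - t0) powr \<beta>) \<in> borel_measurable (lebesgue_on {c..b})"
        "bounded ((\<lambda>s. (s - t0) powr \<beta>) ` {c..b})"
        by (auto intro: continuous_imp_measurable_on_sets_lebesgue compact_imp_bounded compact_continuous_image)
    qed auto
    moreover have "(s - t0) powr \<beta> * ((s - t0) powr (- \<beta>) * p s) = p s" if "s \<in> {c..b}" for s
      using that t0 by (simp add: mult.assoc[symmetric] powr_add[symmetric])
    ultimately show ?thesis
      by (metis (no_types, lifting) set_integrable_cong)
  qed
  then have "integrable lebesgue (\<lambda>x. indicator {c..b} x * p x)"
    by (simp add: set_integrable_def)
  then obtain p' where p': "p' \<in> borel_measurable borel" "integrable lborel p'"
    "AE x in lborel. indicator {c..b} x * p x = p' x"
    using lebesgue_integrable_borel_version by metis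
  have [measurable]: "p' \<in> borel_measurable borel" by fact
  \<comment> \<open>The version \<open>p'\<close> vanishes beyond \<open>b\<close> only almost
    everywhere, while the mass of the kernel has to be bounded wherever \<open>p'\<close> is
    nonzero; hence the cutoff inside \<open>k\<close>.\<close>
  define k where "k = (\<lambda>(x, s). indicator {..b} x * (abel_kernel \<beta> (x - s) * h' s))"
  have km: "k \<in> borel_measurable borel"
    unfolding k_def borel_prod[symmetric] by measurable
  define C where "C = M * (max 0 (b - c) powr (1 - \<beta>) / (1 - \<beta>))"
  have kb: "(\<integral>\<^sup>+s. ennreal \<bar>k (x, s)\<bar> \<partial>lborel) \<le> ennreal C" for x
  proof -
    have "(\<integral>\<^sup>+s. ennreal \<bar>k (x, s)\<bar> \<partial>lborel) \<le> (\<integral>\<^sup>+s. ennreal (M * (indicator {c..} s * abel_kernel \<beta> (min x b - s))) \<partial>lborel)"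
    proof (intro nn_integral_mono ennreal_leI)
      fix s
      show "\<bar>k (x, s)\<bar> \<le> M * (indicator {c..} s * abel_kernel \<beta> (min x b - s))"
      proof (cases "x \<le> b \<and> c \<le> s")
        case True
        have "\<bar>k (x, s)\<bar> = abel_kernel \<beta> (x - s) * \<bar>h' s\<bar>" using True by (simp add: k_def abs_mult)
        also have "\<dots> \<le> abel_kernel \<beta> (x - s) * M" by (intro mult_left_mono h') auto
        finally show ?thesis using True by (simp add: min_def mult.commute)
      next
        case False
        then show ?thesis using M0 h'0[of s] by (auto simp: k_def)
      qed
    qed
    also have "\<dots> = ennreal (LINT s|lborel. M * (indicator {c..} s * abel_kernel \<beta> (min x b - s)))"
      using has_bochner_integral_abel_kernel_reflect[OF \<beta>(2), of c "min x b"] M0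
      by (intro nn_integral_eq_integral) (auto simp: has_bochner_integral_iff)
    also have "\<dots> = ennreal (M * (max 0 (min x b - c) powr (1 - \<beta>) / (1 - \<beta>)))"
      using has_bochner_integral_abel_kernel_reflect[OF \<beta>(2), of c "min x b"] by (simp add: has_bochner_integral_iff)
    also have "\<dots> \<le> ennreal C"
      unfolding C_def using M0 \<beta> by (intro ennreal_leI mult_left_mono divide_right_mono powr_mono2) auto
    finally show ?thesis .
  qed
  note swap = kernel_swap[OF p'(2) km kb]
  have ind: "p' x * indicator {..b} x = indicator {c..b} x * p x" if "indicator {c..b} x * p x = p' x" for x
    using that[symmetric] by (auto simp: indicator_def)
  have A: "(LINT s|lborel. p' x * k (x, s)) = p' x * indicator {..b} x * abel_transform \<beta> h' x" for x
    by (simp add: k_def abel_transform_def mult.assoc)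
  \<comment> \<open>The two cutoffs differ at \<open>b\<close>, a null set, and left of
    \<open>c\<close>, where the transform is zero.\<close>
  have ae1: "AE x in lborel. p' x * indicator {..b} x * abel_transform \<beta> h' x = indicator {a<..<b} x * (p x * abel_transform \<beta> h' x)"
    using p'(3) AE_lborel_singleton[of b]
  proof eventually_elim
    case (elim x)
    show ?case
      unfolding ind[OF elim(1)] using elim(2) ac abel_transform_eq_0[of c h' x \<beta>] h'0
      by (auto simp: indicator_def not_le)
  qed
  have 1: "has_bochner_integral lebesgue (\<lambda>x. indicator {a<..<b} x * (p x * abel_transform \<beta> h' x))
     (LINT x|lborel. LINT s|lborel. p' x * k (x, s))"
  proof -
    let ?f = "\<lambda>x. LINT s|lborel. p' x * k (x, s)"
    let ?g = "\<lambda>x. indicator {a<..<b} x * (p x * abel_transform \<beta> h' x)"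
    have f: "integrable lebesgue ?f" using swap(1) by (rule integrable_lebesgue_of_lborel)
    have ae: "AE x in lebesgue. ?f x = ?g x"
      using ae1 unfolding A by (rule AE_completion)
    have g: "?g \<in> borel_measurable lebesgue"
      using f ae by (intro borel_measurable_AE[of ?f ?g]) auto
    have "has_bochner_integral lebesgue ?f (LINT x|lborel. ?f x)"
      using f swap(1) by (simp add: has_bochner_integral_iff integral_completion)
    then show ?thesis
      using has_bochner_integral_cong_AE[OF _ g ae] f by auto
  qed
  have B: "(LINT x|lborel. p' x * k (x, s)) = h' s * R s" for s
  proof (cases "s \<in> {c<..<d}")
    case True
    have ii: "integrable lebesgue (\<lambda>x. indicator {s..b} x * ((x - s) powr (- \<beta>) * p x))"
      using p[of s] True ac by (simp add: set_integrable_def)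
    have "AE x in lborel. indicator {s..b} x * ((x - s) powr (- \<beta>) * p x) * h' s = p' x * k (x, s)"
      using p'(3)
    proof eventually_elim
      case (elim x)
      show ?case
        using ind[OF elim] True by (auto simp: k_def indicator_def abel_kernel_def)
    qed
    then have "(LINT x|lborel. p' x * k (x, s)) = (LINT x|lebesgue. indicator {s..b} x * ((x - s) powr (- \<beta>) * p x) * h' s)"
      using ii km by (intro integrable_lborel_cong_lebesgue(2)) (auto simp: k_def)
    also have "\<dots> = (LINT x:{s..b}|lebesgue. (x - s) powr (- \<beta>) * p x) * h' s"
      by (simp add: set_lebesgue_integral_def)
    also have "\<dots> = R s * h' s"
      unfolding R_def using p[of s] True ac by (subst set_lebesgue_integral_eq_integral(2)) auto
    finally show ?thesis by simp
  next
    case False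
    then show ?thesis using h'(3)[of s] by (simp add: k_def)
  qed
  have q': "\<And>t. t \<in> {a<..<b} \<Longrightarrow> (R has_real_derivative q t) (at t)"
    using q(1) unfolding R_def .
  have Rc: "continuous_on {c..d} R"
    using ac by (intro continuous_at_imp_continuous_on ballI DERIV_isCont[OF q']) auto
  have hc: "continuous_on UNIV h"
    using h(1) by (meson DERIV_isCont continuous_at_imp_continuous_on)
  have qc: "continuous_on {c..d} (\<lambda>x. h x * q x)"
    using ac by (intro continuous_intros continuous_on_subset[OF q(2)] continuous_on_subset[OF hc]) auto
  have hq: "(\<lambda>x. h x * q x) absolutely_integrable_on {c..d}"
    using qc by (rule absolutely_integrable_continuous_real)
  have hR: "(\<lambda>x. h' x * R x) absolutely_integrable_on {c..d}"
    using Rc by (intro absolutely_integrable_continuous_real continuous_intros continuous_on_subset[OF h'(1)]) auto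
  have eq3: "(\<lambda>x. indicator {c..d} x *\<^sub>R (h x * q x)) = (\<lambda>x. indicator {a<..<b} x * (h x * q x))"
  proof
    fix x
    show "indicator {c..d} x *\<^sub>R (h x * q x) = indicator {a<..<b} x * (h x * q x)"
      using ac h(2)[of x] by (cases "x \<in> {c<..<d}") (auto simp: indicator_def)
  qed
  show 3: "integrable lebesgue (\<lambda>x. indicator {a<..<b} x * (h x * q x))"
    using hq unfolding set_integrable_def eq3 .
  have "((\<lambda>x. h' x * R x) has_integral (- integral {c..d} (\<lambda>x. h x * q x))) {c..d}"
  proof (rule integration_by_parts[OF bounded_bilinear_mult ac(2) continuous_on_subset[OF hc] Rc])
    show "\<And>x. x \<in> {c..d} \<Longrightarrow> (h has_vector_derivative h' x) (at x)"
      using h(1) by (simp add: has_real_derivative_iff_has_vector_derivative)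
    show "\<And>x. x \<in> {c..d} \<Longrightarrow> (R has_vector_derivative q x) (at x)"
      using q' ac by (auto simp flip: has_real_derivative_iff_has_vector_derivative)
    show "((\<lambda>x. h x * q x) has_integral h d * R d - h c * R c - - integral {c..d} (\<lambda>x. h x * q x)) {c..d}"
      using hq h(2)[of c] h(2)[of d] by (simp add: set_lebesgue_integral_eq_integral(1) integrable_integral)
  qed auto
  then have 4: "integral {c..d} (\<lambda>x. h' x * R x) = - integral {c..d} (\<lambda>x. h x * q x)"
    by (rule integral_unique)
  have eq5: "(\<lambda>x. indicator {c..d} x *\<^sub>R (h' x * R x)) = (\<lambda>x. h' x * R x)"
  proof
    fix x
    show "indicator {c..d} x *\<^sub>R (h' x * R x) = h' x * R x"
      using h'(3)[of x] by (cases "x \<in> {c<..<d}") (auto simp: indicator_def)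
  qed
  have "(LINT x|lborel. LINT s|lborel. p' x * k (x, s)) = (LINT s|lborel. h' s * R s)"
    using swap(3) by (simp add: B)
  also have "\<dots> = (LINT s|lebesgue. h' s * R s)"
    using swap(2) by (subst integral_completion) (auto simp: B)
  also have "\<dots> = integral {c..d} (\<lambda>x. h' x * R x)"
    using set_lebesgue_integral_eq_integral(2)[OF hR] unfolding set_lebesgue_integral_def eq5 .
  also have "\<dots> = - (LINT x|lebesgue. indicator {a<..<b} x * (h x * q x))"
    using set_lebesgue_integral_eq_integral(2)[OF hq] unfolding 4 set_lebesgue_integral_def eq3 by simp
  finally show "(LINT x|lebesgue. indicator {a<..<b} x * (p x * abel_transform \<beta> h' x)) =
       - (LINT x|lebesgue. indicator {a<..<b} x * (h x * q x))"
    using 1 by (simp add: has_bochner_integral_iff)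
  show "integrable lebesgue (\<lambda>x. indicator {a<..<b} x * (p x * abel_transform \<beta> h' x))"
    using 1 by (simp add: has_bochner_integral_iff)
qed

section \<open>Abel's integral equation and the essential bound on its solutions\<close>

lemma AE_zero_if_halfline_integrals_zero:
  fixes F :: "real \<Rightarrow> real"
  assumes F: "integrable lborel F" and 0: "\<And>\<tau>. (LINT x|lborel. indicator {..\<tau>} x * F x) = 0"
  shows "AE x in lborel. F x = 0"
proof (rule AE_zero_if_box_integrals_zero[OF F])
  fix c d :: real
  have [measurable]: "F \<in> borel_measurable borel" using F by auto
  have i: "integrable lborel (\<lambda>x. indicator {..\<tau>} x * F x)" for \<tau>
    using integrable_mult_indicator[OF _ F, of "{..\<tau>}"] by simp
  show "(LINT x|lborel. indicator (box c d) x * F x) = 0"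
  proof (cases "c < d")
    case True
    have "AE x in lborel. indicator (box c d) x * F x = indicator {..d} x * F x - indicator {..c} x * F x"
      using AE_lborel_singleton[of d]
      by eventually_elim (use True in \<open>auto simp: indicator_def box_real\<close>)
    then have "(LINT x|lborel. indicator (box c d) x * F x) = (LINT x|lborel. indicator {..d} x * F x - indicator {..c} x * F x)"
      by (intro integral_cong_AE) auto
    then show ?thesis using i 0 by simp
  next
    case False
    then show ?thesis by (simp add: box_real)
  qed
qed

text \<open>
  Applying the fractional integral of order \<open>\<beta>\<close> to the Abel equation turns its left side into
  \<open>B(1 - \<beta>, \<beta>) \<integral> v\<close>; comparing with the integral of \<open>w\<close>, the Abel integral of \<open>g\<close>, shows \<open>B(1 - \<beta>, \<beta>) v = w\<close>
  almost everywhere.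
\<close>

lemma abel_equation_bounded:
  fixes v g :: "real \<Rightarrow> real"
  assumes \<beta>: "0 < \<beta>" "\<beta> < 1" and ab: "a < b"
    and v: "\<And>t. t \<in> {a..b} \<Longrightarrow> (\<lambda>s. (t - s) powr (- \<beta>) * v s) absolutely_integrable_on {a..t}"
    and g: "\<And>t. t \<in> {a..b} \<Longrightarrow>
        ((\<lambda>t. integral {a..t} (\<lambda>s. (t - s) powr (- \<beta>) * v s)) has_vector_derivative g t) (at t within {a..b})"
      "continuous_on {a..b} g" "\<And>t. t \<in> {a..b} \<Longrightarrow> \<bar>g t\<bar> \<le> M"
  shows "AE s in lebesgue. s \<in> {a..b} \<longrightarrow> \<bar>v s\<bar> \<le> M * ((b - a) powr \<beta> / \<beta>) / Beta (1 - \<beta>) \<beta>"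
proof -
  define G where "G t = integral {a..t} (\<lambda>s. (t - s) powr (- \<beta>) * v s)" for t
  define B where "B = Beta (1 - \<beta>) \<beta>"
  have B: "0 < B" using \<beta> by (simp add: B_def Beta_def Gamma_real_pos)
  have M0: "0 \<le> M" using g(3)[of a] ab by auto
  \<comment> \<open>The weight at t = b is divided out by multiplying with a bounded continuous
    power. At \<open>b\<close> itself the product is zero by the convention for
    \<open>0 powr _\<close>, so that point is treated as a spike.\<close>
  have "v absolutely_integrable_on {a..b}"
  proof -
    have "(\<lambda>s. (b - s) powr \<beta> * ((b - s) powr (- \<beta>) * v s)) absolutely_integrable_on {a..b}"
    proof (rule absolutely_integrable_bounded_measurable_product_real[rotated 3])
      show "(\<lambda>s. (b - s) powr (- \<beta>) * v s) absolutely_integrable_on {a..b}" using v[of b] ab by auto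
      have "continuous_on {a..b} (\<lambda>s. (b - s) powr \<beta>)"
        using \<beta> by (intro continuous_on_powr' continuous_intros) auto
      then show "(\<lambda>s. (b - s) powr \<beta>) \<in> borel_measurable (lebesgue_on {a..b})"
        "bounded ((\<lambda>s. (b - s) powr \<beta>) ` {a..b})"
        by (auto intro: continuous_imp_measurable_on_sets_lebesgue compact_imp_bounded compact_continuous_image)
    qed auto
    then show ?thesis
    proof (rule absolutely_integrable_spike[where S = "{b}"])
      fix s assume "s \<in> {a..b} - {b}"
      then show "v s = (b - s) powr \<beta> * ((b - s) powr (- \<beta>) * v s)"
        by (simp add: mult.assoc[symmetric] powr_add[symmetric])
    qed auto
  qed
  then have "integrable lebesgue (\<lambda>x. indicator {a..b} x * v x)"
    by (simp add: set_integrable_def)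
  then obtain v' where v': "v' \<in> borel_measurable borel" "integrable lborel v'"
    "AE x in lborel. indicator {a..b} x * v x = v' x"
    using lebesgue_integrable_borel_version by metis
  have [measurable]: "v' \<in> borel_measurable borel" by fact
  define g' where "g' s = indicator {a..b} s * g s" for s
  have g': "integrable lborel g'"
    using borel_integrable_compact[OF _ g(2)] by (simp add: g'_def[abs_def])
  have [measurable]: "g' \<in> borel_measurable borel" using g' by auto
  have g'M: "\<bar>g' s\<bar> \<le> M * indicator {a..} s" for s
    using g(3)[of s] M0 by (auto simp: g'_def indicator_def)
  define w where "w t = (LINT s|lborel. g' s * abel_kernel (1 - \<beta>) (t - s))" for t

  have Gg: "G t = (LINT s|lborel. g' s * indicator {..t} s)" if t: "t \<in> {a..b}" for t
  proof -
    have "(g has_integral G t - G a) {a..t}"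
    proof (rule fundamental_theorem_of_calculus)
      show "(G has_vector_derivative g x) (at x within {a..t})" if "x \<in> {a..t}" for x
        using has_vector_derivative_within_subset[OF g(1)[of x], of "{a..t}"] that t by (auto simp: G_def[abs_def])
    qed (use t in auto)
    then have "integral {a..t} g = G t"
      by (auto simp: G_def dest: integral_unique)
    moreover have "g absolutely_integrable_on {a..t}"
      using t by (intro absolutely_integrable_continuous_real continuous_on_subset[OF g(2)]) auto
    ultimately have "G t = (LINT s:{a..t}|lebesgue. g s)"
      by (simp add: set_lebesgue_integral_eq_integral(2))
    also have "\<dots> = (LINT s|lebesgue. g' s * indicator {..t} s)"
      unfolding set_lebesgue_integral_def using t
      by (intro Bochner_Integration.integral_cong refl) (auto simp: g'_def indicator_def)
    also have "\<dots> = (LINT s|lborel. g' s * indicator {..t} s)"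
      by (rule integral_completion) measurable
    finally show ?thesis .
  qed
  \<comment> \<open>Abel's equation after one integration in \<open>t\<close>. It extends to t below
    \<open>a\<close>, where both sides are zero, because the second kernel will be integrated over
    the whole half-line up to \<open>\<tau>\<close>.\<close>
  have Gv: "(LINT s|lborel. v' s * abel_kernel \<beta> (t - s)) = (LINT s|lborel. g' s * indicator {..t} s)" if t: "t \<le> b" for t
  proof (cases "a \<le> t")
    case True
    have ii: "integrable lebesgue (\<lambda>s. indicator {a..t} s * ((t - s) powr (- \<beta>) * v s))"
      using v[of t] True t by (simp add: set_integrable_def)
    have "AE s in lborel. indicator {a..t} s * ((t - s) powr (- \<beta>) * v s) = v' s * abel_kernel \<beta> (t - s)"
      using v'(3)
    proof eventually_elim
      case (elim s)
      show ?case unfolding elim[symmetric] using t by (auto simp: indicator_def abel_kernel_def)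
    qed
    then have "(LINT s|lborel. v' s * abel_kernel \<beta> (t - s)) = (LINT s:{a..t}|lebesgue. (t - s) powr (- \<beta>) * v s)"
      using integrable_lborel_cong_lebesgue(2)[OF ii, of "\<lambda>s. v' s * abel_kernel \<beta> (t - s)"]
      by (simp add: set_lebesgue_integral_def)
    also have "\<dots> = G t"
      unfolding G_def using v[of t] True t by (subst set_lebesgue_integral_eq_integral(2)) auto
    finally show ?thesis using Gg[of t] True t by simp
  next
    case False
    have "(LINT s|lborel. v' s * abel_kernel \<beta> (t - s)) = (LINT s::real|lborel. 0)"
    proof (rule integral_cong_AE)
      show "AE s in lborel. v' s * abel_kernel \<beta> (t - s) = 0"
        using v'(3)
      proof eventually_elim
        case (elim s)
        show ?case unfolding elim[symmetric] using False by (auto simp: indicator_def abel_kernel_def)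
      qed
    qed auto
    moreover have "(\<lambda>s. g' s * indicator {..t} s) = (\<lambda>s. 0)"
      using False by (auto simp: g'_def indicator_def)
    ultimately show ?thesis by simp
  qed

  have kern: "(\<integral>\<^sup>+t. ennreal \<bar>f t\<bar> \<partial>lborel) = ennreal I"
    if "has_bochner_integral lborel f I" "\<And>t. 0 \<le> f t" for f :: "real \<Rightarrow> real" and I
    using that by (subst nn_integral_eq_integral) (auto simp: has_bochner_integral_iff)
  have \<beta>': "1 - \<beta> < 1" using \<beta> by simp

  have k1: "(\<lambda>(s, t). abel_kernel (1 - \<beta>) (\<tau> - t) * abel_kernel \<beta> (t - s)) \<in> borel_measurable borel" for \<tau> :: real
    unfolding borel_prod[symmetric] by measurable
  have k2: "(\<lambda>(s, t). indicator {s..} t * abel_kernel (1 - \<beta>) (\<tau> - t)) \<in> borel_measurable borel" for \<tau> :: real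
  proof -
    have "(\<lambda>(s, t). indicator {s..} t * abel_kernel (1 - \<beta>) (\<tau> - t)) = (\<lambda>(s::real, t). indicator {0..} (t - s) * abel_kernel (1 - \<beta>) (\<tau> - t))"
      by (auto simp: fun_eq_iff indicator_def)
    then show ?thesis unfolding borel_prod[symmetric] by simp
  qed
  have k3: "(\<lambda>(s, t). indicator {..\<tau>} t * abel_kernel (1 - \<beta>) (t - s)) \<in> borel_measurable borel" for \<tau> :: real
    unfolding borel_prod[symmetric] by measurable

  \<comment> \<open>Three exchanges of integrals: the first collapses the two kernels acting on
    \<open>v'\<close> to the constant \<open>B\<close>; the second, after inserting
    \<open>Gv\<close>, brings the kernel inside the integral of \<open>g'\<close>; the third takes
    the integration over \<open>{..\<tau>}\<close> outside again.\<close>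
  have main: "(LINT s|lborel. v' s * (if s < \<tau> then B else 0)) = (LINT t|lborel. indicator {..\<tau>} t * w t)"
    and wint: "integrable lborel (\<lambda>t. indicator {..\<tau>} t * w t)" if \<tau>: "\<tau> \<in> {a..b}" for \<tau>
  proof -
    have c1: "(\<integral>\<^sup>+t. ennreal \<bar>case (s, t) of (s, t) \<Rightarrow> abel_kernel (1 - \<beta>) (\<tau> - t) * abel_kernel \<beta> (t - s)\<bar> \<partial>lborel) \<le> ennreal B" for s
      using kern[OF has_bochner_integral_abel_kernel_product[OF \<beta>, of \<tau> s]] B by (simp add: B_def)
    have P: "max 0 (\<tau> - s) powr \<beta> / \<beta> \<le> (b - a) powr \<beta> / \<beta>" if "g' s \<noteq> 0" for s
      using that \<tau> \<beta> by (intro divide_right_mono powr_mono2) (auto simp: g'_def indicator_def split: if_splits)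
    have c2: "(\<integral>\<^sup>+t. ennreal \<bar>case (s, t) of (s, t) \<Rightarrow> indicator {s..} t * abel_kernel (1 - \<beta>) (\<tau> - t)\<bar> \<partial>lborel) \<le> ennreal ((b - a) powr \<beta> / \<beta>)"
      if "g' s \<noteq> 0" for s
      using kern[OF has_bochner_integral_abel_kernel_reflect[OF \<beta>', of s \<tau>]] P[OF that] by (simp add: ennreal_leI)
    have c3: "(\<integral>\<^sup>+t. ennreal \<bar>case (s, t) of (s, t) \<Rightarrow> indicator {..\<tau>} t * abel_kernel (1 - \<beta>) (t - s)\<bar> \<partial>lborel) \<le> ennreal ((b - a) powr \<beta> / \<beta>)"
      if "g' s \<noteq> 0" for s
      using kern[OF has_bochner_integral_abel_kernel_shift[OF \<beta>', of \<tau> s]] P[OF that] by (simp add: ennreal_leI)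
    note s1 = kernel_swap[OF v'(2) k1 c1] and s2 = kernel_swap[OF g' k2 c2] and s3 = kernel_swap[OF g' k3 c3]
    have i1: "(LINT t|lborel. abel_kernel (1 - \<beta>) (\<tau> - t) * abel_kernel \<beta> (t - s)) = (if s < \<tau> then B else 0)" for s
      using has_bochner_integral_abel_kernel_product[OF \<beta>, of \<tau> s] by (simp add: has_bochner_integral_iff B_def)
    \<comment> \<open>Both sides depend on \<tau> - s only. This says that the fractional integral
      of the primitive of \<open>g'\<close> is the primitive of its fractional integral
      \<open>w\<close>.\<close>
    have i2: "(LINT t|lborel. indicator {s..} t * abel_kernel (1 - \<beta>) (\<tau> - t)) = (LINT t|lborel. indicator {..\<tau>} t * abel_kernel (1 - \<beta>) (t - s))" for s
      using has_bochner_integral_abel_kernel_reflect[OF \<beta>', of s \<tau>] has_bochner_integral_abel_kernel_shift[OF \<beta>', of \<tau> s]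
      by (simp add: has_bochner_integral_iff)
    have m3: "(LINT s|lborel. g' s * (case (s, t) of (s, t) \<Rightarrow> indicator {..\<tau>} t * abel_kernel (1 - \<beta>) (t - s))) = indicator {..\<tau>} t * w t" for t
      unfolding w_def integral_mult_right_zero[symmetric] by (rule Bochner_Integration.integral_cong) auto
    have m2: "(LINT s|lborel. g' s * (case (s, t) of (s, t) \<Rightarrow> indicator {s..} t * abel_kernel (1 - \<beta>) (\<tau> - t)))
       = abel_kernel (1 - \<beta>) (\<tau> - t) * (LINT s|lborel. g' s * indicator {..t} s)" for t
      unfolding integral_mult_right_zero[symmetric] by (rule Bochner_Integration.integral_cong) (auto simp: indicator_def)
    have m1: "(LINT s|lborel. v' s * (case (s, t) of (s, t) \<Rightarrow> abel_kernel (1 - \<beta>) (\<tau> - t) * abel_kernel \<beta> (t - s)))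
       = abel_kernel (1 - \<beta>) (\<tau> - t) * (LINT s|lborel. v' s * abel_kernel \<beta> (t - s))" for t
      unfolding integral_mult_right_zero[symmetric] by (rule Bochner_Integration.integral_cong) auto
    have m12: "abel_kernel (1 - \<beta>) (\<tau> - t) * (LINT s|lborel. v' s * abel_kernel \<beta> (t - s)) =
      abel_kernel (1 - \<beta>) (\<tau> - t) * (LINT s|lborel. g' s * indicator {..t} s)" for t
      using Gv[of t] \<tau> by (cases "t \<le> b") (auto simp: abel_kernel_def)
    show "integrable lborel (\<lambda>t. indicator {..\<tau>} t * w t)"
      using s3(2) unfolding m3 .
    have "(LINT s|lborel. v' s * (if s < \<tau> then B else 0))
       = (LINT t|lborel. abel_kernel (1 - \<beta>) (\<tau> - t) * (LINT s|lborel. v' s * abel_kernel \<beta> (t - s)))"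
      using s1(3) unfolding m1 by (simp add: i1)
    also have "\<dots> = (LINT s|lborel. g' s * (LINT t|lborel. indicator {s..} t * abel_kernel (1 - \<beta>) (\<tau> - t)))"
      using s2(3) unfolding m2 m12 by simp
    also have "\<dots> = (LINT t|lborel. indicator {..\<tau>} t * w t)"
      using s3(3) unfolding m3 i2 by simp
    finally show "(LINT s|lborel. v' s * (if s < \<tau> then B else 0)) = (LINT t|lborel. indicator {..\<tau>} t * w t)" .
  qed

  define F where "F s = B * v' s - indicator {..b} s * w s" for s
  have wb: "integrable lborel (\<lambda>t. indicator {..b} t * w t)" using wint[of b] ab by simp
  have F: "integrable lborel F" unfolding F_def using wb v'(2) by simp
  have w0: "w s = 0" if "s < a" for s
  proof -
    have "(\<lambda>r. g' r * abel_kernel (1 - \<beta>) (s - r)) = (\<lambda>r. 0)"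
      using that by (auto simp: fun_eq_iff g'_def indicator_def abel_kernel_def)
    then show ?thesis by (simp add: w_def)
  qed
  have Fout: "AE s in lborel. s \<notin> {a..b} \<longrightarrow> F s = 0"
    using v'(3) by eventually_elim (auto simp: F_def indicator_def w0)
  have F0: "(LINT x|lborel. indicator {..\<tau>} x * F x) = 0" if \<tau>: "\<tau> \<in> {a..b}" for \<tau>
  proof -
    have "AE x in lborel. indicator {..\<tau>} x * F x = v' x * (if x < \<tau> then B else 0) - indicator {..\<tau>} x * w x"
      using AE_lborel_singleton[of \<tau>]
      by eventually_elim (use \<tau> in \<open>auto simp: F_def indicator_def\<close>)
    then have "(LINT x|lborel. indicator {..\<tau>} x * F x) = (LINT x|lborel. v' x * (if x < \<tau> then B else 0) - indicator {..\<tau>} x * w x)"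
      using F wint[OF \<tau>] by (intro integral_cong_AE) auto
    also have "\<dots> = (LINT x|lborel. v' x * (if x < \<tau> then B else 0)) - (LINT x|lborel. indicator {..\<tau>} x * w x)"
    proof (rule Bochner_Integration.integral_diff[OF _ wint[OF \<tau>]])
      have "(\<lambda>x. v' x * (if x < \<tau> then B else 0)) = (\<lambda>x. indicator {..<\<tau>} x *\<^sub>R (v' x * B))"
        by (auto simp: fun_eq_iff)
      then show "integrable lborel (\<lambda>x. v' x * (if x < \<tau> then B else 0))"
        using integrable_mult_indicator[of "{..<\<tau>}" lborel "\<lambda>x. v' x * B"] v'(2) by simp
    qed
    finally show ?thesis using main[OF \<tau>] by simp
  qed
  have "AE x in lborel. F x = 0"
  proof (rule AE_zero_if_halfline_integrals_zero[OF F])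
    fix \<tau> :: real
    have [measurable]: "F \<in> borel_measurable borel" using F by auto
    \<comment> \<open>\<open>F\<close> vanishes almost everywhere outside \<open>{a..b}\<close>, so
      \<open>\<tau>\<close> may be clamped to the interval on which the identity is known.\<close>
    have "(LINT x|lborel. indicator {..\<tau>} x * F x) = (LINT x|lborel. indicator {..max a (min b \<tau>)} x * F x)"
    proof (rule integral_cong_AE)
      show "AE x in lborel. indicator {..\<tau>} x * F x = indicator {..max a (min b \<tau>)} x * F x"
        using Fout AE_lborel_singleton[of a]
        by eventually_elim (auto simp: indicator_def)
    qed auto
    also have "\<dots> = 0" using ab by (intro F0) auto
    finally show "(LINT x|lborel. indicator {..\<tau>} x * F x) = 0" .
  qed
  then have "AE s in lborel. s \<in> {a..b} \<longrightarrow> \<bar>v s\<bar> \<le> M * ((b - a) powr \<beta> / \<beta>) / B"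
    using v'(3)
  proof eventually_elim
    case (elim s)
    show ?case
    proof
      assume s: "s \<in> {a..b}"
      then have "B * v s = w s" using elim by (simp add: F_def)
      \<comment> \<open>Origin of the constant: \<open>w\<close> is at most \<open>M\<close> times
        the mass of the kernel of order 1 - \<beta> on \<open>{a..s}\<close>, which is largest at s
        = b.\<close>
      have "norm (w s) \<le> (LINT r::real|lborel. M * (indicator {a..} r * abel_kernel (1 - \<beta>) (s - r)))"
        unfolding w_def
      proof (rule Bochner_Integration.integral_norm_bound_integral)
        show h: "integrable lborel (\<lambda>r. M * (indicator {a..} r * abel_kernel (1 - \<beta>) (s - r)))"
          using has_bochner_integral_abel_kernel_reflect[OF \<beta>', of a s] by (simp add: has_bochner_integral_iff)
        show le: "norm (g' r * abel_kernel (1 - \<beta>) (s - r)) \<le> M * (indicator {a..} r * abel_kernel (1 - \<beta>) (s - r))" for r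
          using mult_right_mono[OF g'M[of r], of "abel_kernel (1 - \<beta>) (s - r)"] by (simp add: abs_mult mult.assoc)
        show "integrable lborel (\<lambda>r. g' r * abel_kernel (1 - \<beta>) (s - r))"
        proof (rule Bochner_Integration.integrable_bound[OF h])
          show "AE r in lborel. norm (g' r * abel_kernel (1 - \<beta>) (s - r)) \<le> norm (M * (indicator {a..} r * abel_kernel (1 - \<beta>) (s - r)))"
            using order_trans[OF le abs_ge_self] by simp
        qed auto
      qed
      also have "\<dots> = M * (max 0 (s - a) powr \<beta> / \<beta>)"
        using has_bochner_integral_abel_kernel_reflect[OF \<beta>', of a s] by (simp add: has_bochner_integral_iff)
      also have "\<dots> \<le> M * ((b - a) powr \<beta> / \<beta>)"
        using s M0 \<beta> by (intro mult_left_mono divide_right_mono powr_mono2) auto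
      finally have "B * \<bar>v s\<bar> \<le> M * ((b - a) powr \<beta> / \<beta>)"
        unfolding \<open>B * v s = w s\<close>[symmetric] using B by (simp add: abs_mult)
      then show "\<bar>v s\<bar> \<le> M * ((b - a) powr \<beta> / \<beta>) / B"
        unfolding pos_le_divide_eq[OF B] by (simp only: mult.commute)
    qed
  qed
  then show ?thesis unfolding B_def by (rule AE_completion)
qed

section \<open>Riemann--Liouville derivatives on a box\<close>

lemma AE_lebesgue_shift:
  fixes c :: real
  assumes "AE t in lebesgue. P t"
  shows "AE s in lebesgue. P (c + s)"
proof -
  obtain N where N: "N \<in> null_sets lebesgue" "{t. \<not> P t} \<subseteq> N"
    using assms unfolding eventually_ae_filter by auto
  have "negligible ((+) (- c) ` N)"
    using N(1) by (intro negligible_translation) (simp add: negligible_iff_null_sets)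
  then have "(+) (- c) ` N \<in> null_sets lebesgue"
    by (simp add: negligible_iff_null_sets)
  moreover have "{s. \<not> P (c + s)} \<subseteq> (+) (- c) ` N"
  proof
    fix s assume "s \<in> {s. \<not> P (c + s)}"
    then have "c + s \<in> N" using N(2) by auto
    then show "s \<in> (+) (- c) ` N" by (intro image_eqI[where x = "c + s"]) auto
  qed
  ultimately show ?thesis unfolding eventually_ae_filter by auto
qed

lemma has_bochner_integral_lebesgue_shift:
  fixes f :: "real \<Rightarrow> real"
  assumes "has_bochner_integral lebesgue f x"
  shows "has_bochner_integral lebesgue (\<lambda>s. f (c + s)) x"
proof -
  have f: "integrable lebesgue f" "integral\<^sup>L lebesgue f = x"
    using assms by (auto simp: has_bochner_integral_iff)
  obtain g where g: "g \<in> borel_measurable borel" "integrable lborel g" "AE t in lebesgue. f t = g t"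
    "integral\<^sup>L lborel g = x"
    using lebesgue_integrable_borel_version[OF f(1)] f(2) by metis
  have [measurable]: "g \<in> borel_measurable borel" by fact
  have "has_bochner_integral lborel (\<lambda>s. g (c + 1 * s)) (x /\<^sub>R \<bar>1\<bar>)"
    using g by (subst lborel_has_bochner_integral_real_affine_iff[symmetric]) (auto simp: has_bochner_integral_iff)
  then have 1: "has_bochner_integral lebesgue (\<lambda>s. g (c + s)) x"
    by (simp add: has_bochner_integral_iff integrable_completion integral_completion)
  have ae: "AE s in lebesgue. g (c + s) = f (c + s)"
    using AE_lebesgue_shift[OF g(3), of c] by eventually_elim simp
  have m: "(\<lambda>s. g (c + s)) \<in> borel_measurable lebesgue"
    using 1 by (auto simp: has_bochner_integral_iff)
  then have "(\<lambda>s. f (c + s)) \<in> borel_measurable lebesgue"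
    by (rule borel_measurable_AE[OF _ ae])
  then show ?thesis using has_bochner_integral_cong_AE[OF m _ ae] 1 by blast
qed

section \<open>Lines parametrised by the coordinate itself\<close>

lemma coord_update_eq: "coord_update x k s = x + (s - x $ k) *\<^sub>R axis k 1"
  by (simp add: vec_eq_iff coord_update_def axis_def)

lemma coord_update_nth [simp]: "coord_update x k s $ i = (if i = k then s else x $ i)"
  by (simp add: coord_update_def)

lemma coord_update_coord_update [simp]: "coord_update (coord_update x k t) k s = coord_update x k s"
  by (simp add: vec_eq_iff)

lemma coord_update_self [simp]: "coord_update x k (x $ k) = x"
  by (simp add: vec_eq_iff)

lemma coord_update_mem_cbox: "x \<in> cbox a b \<Longrightarrow> t \<in> {a $ k..b $ k} \<Longrightarrow> coord_update x k t \<in> cbox a b"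
  by (auto simp: mem_box_cart)

text \<open>The slab formula measures displacement from a base point, the fractional derivatives use
  the coordinate value. The two parametrisations differ by a shift, under which Lebesgue integrals
  and null sets are invariant.\<close>

lemma add_axis_eq_coord_update: "y + s *\<^sub>R axis k 1 = coord_update y k (y $ k + s)"
  by (simp add: coord_update_eq)

lemma integral_zero_if_zero_along_coordinate:
  fixes F :: "real ^ 'n \<Rightarrow> real"
  assumes F: "integrable lebesgue F"
    and line: "\<And>y. has_bochner_integral lebesgue (\<lambda>t. F (coord_update y k t)) 0"
  shows "integral\<^sup>L lebesgue F = 0"
proof (rule integral_zero_if_zero_along_lines[OF F, of "axis k 1"])
  show "integrable lebesgue (\<lambda>s. F (y + s *\<^sub>R axis k 1))" "(LINT s|lebesgue. F (y + s *\<^sub>R axis k 1)) = 0" for y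
    using has_bochner_integral_lebesgue_shift[OF line[of y], of "y $ k"]
    unfolding add_axis_eq_coord_update by (auto simp: has_bochner_integral_iff)
qed simp

lemma AE_if_AE_along_coordinate:
  fixes N :: "(real ^ 'n) set"
  assumes N: "N \<in> sets lebesgue" and line: "\<And>y. AE t in lebesgue. coord_update y k t \<notin> N"
  shows "AE x in lebesgue. x \<notin> N"
proof (rule AE_if_AE_along_lines[OF N, of "axis k 1"])
  show "AE s in lebesgue. y + s *\<^sub>R axis k 1 \<notin> N" for y
    unfolding add_axis_eq_coord_update by (rule AE_lebesgue_shift[OF line])
qed simp

lemma left_RL_integrand_coord_update [simp]:
  "left_RL_integrand \<beta> k f (coord_update x k r) = left_RL_integrand \<beta> k f x"
  by (simp add: fun_eq_iff left_RL_integrand_def)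

lemma right_RL_integrand_coord_update [simp]:
  "right_RL_integrand \<beta> k f (coord_update x k r) = right_RL_integrand \<beta> k f x"
  by (simp add: fun_eq_iff right_RL_integrand_def)

text \<open>The integrand ignores the \<open>k\<close>-th coordinate of \<open>x\<close>, so the
  conditions at the separate points of one line combine into statements about a single function of
  \<open>t\<close>. The factor \<open>Gamma (1 - \<beta>)\<close> undoes the normalisation.\<close>

lemma has_left_RL_derivD:
  assumes \<beta>: "\<beta> < 1" and x: "x \<in> cbox a b"
    and f: "\<And>x. x \<in> cbox a b \<Longrightarrow> has_left_RL_deriv a b \<beta> k f x"
    and t: "t \<in> {a $ k..b $ k}"
  shows "left_RL_integrand \<beta> k f x t absolutely_integrable_on {a $ k..t}"
    and "((\<lambda>t. integral {a $ k..t} (left_RL_integrand \<beta> k f x t)) has_vector_derivative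
       Gamma (1 - \<beta>) * left_RL_deriv a b \<beta> k f (coord_update x k t)) (at t within {a $ k..b $ k})"
proof -
  have "has_left_RL_deriv a b \<beta> k f (coord_update x k t)"
    using f coord_update_mem_cbox[OF x t] by blast
  then have 1: "left_RL_integrand \<beta> k f x t absolutely_integrable_on {a $ k..t}"
    and 2: "(\<lambda>t. integral {a $ k..t} (left_RL_integrand \<beta> k f x t)) differentiable (at t within {a $ k..b $ k})"
    by (simp_all add: has_left_RL_deriv_def)
  show "left_RL_integrand \<beta> k f x t absolutely_integrable_on {a $ k..t}" by (rule 1)
  have "0 < Gamma (1 - \<beta>)" using \<beta> by (intro Gamma_real_pos) simp
  then have "Gamma (1 - \<beta>) \<noteq> 0" by simp
  then show "((\<lambda>t. integral {a $ k..t} (left_RL_integrand \<beta> k f x t)) has_vector_derivative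
       Gamma (1 - \<beta>) * left_RL_deriv a b \<beta> k f (coord_update x k t)) (at t within {a $ k..b $ k})"
    using 2 by (simp add: left_RL_deriv_def vector_derivative_works)
qed

lemma left_RL_derivI:
  assumes \<beta>: "\<beta> < 1" and x: "x \<in> cbox a b" and ab: "a $ k < b $ k"
    and "left_RL_integrand \<beta> k f x (x $ k) absolutely_integrable_on {a $ k..x $ k}"
    and D: "((\<lambda>t. integral {a $ k..t} (left_RL_integrand \<beta> k f x t)) has_vector_derivative D)
       (at (x $ k) within {a $ k..b $ k})"
  shows "has_left_RL_deriv a b \<beta> k f x" "left_RL_deriv a b \<beta> k f x = D / Gamma (1 - \<beta>)"
proof -
  have "x $ k \<in> {a $ k..b $ k}" using x by (auto simp: mem_box_cart)
  then have "vector_derivative (\<lambda>t. integral {a $ k..t} (left_RL_integrand \<beta> k f x t)) (at (x $ k) within {a $ k..b $ k}) = D"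
    using D ab by (intro vector_derivative_within_closed_interval) auto
  then show "left_RL_deriv a b \<beta> k f x = D / Gamma (1 - \<beta>)" by (simp add: left_RL_deriv_def)
  show "has_left_RL_deriv a b \<beta> k f x"
    using assms unfolding has_left_RL_deriv_def by (auto intro: differentiableI_vector)
qed

lemma has_right_RL_derivD:
  assumes \<beta>: "\<beta> < 1" and x: "x \<in> box a b"
    and f: "\<And>x. x \<in> box a b \<Longrightarrow> has_right_RL_deriv a b \<beta> k f x"
    and t: "t \<in> {a $ k<..<b $ k}"
  shows "right_RL_integrand \<beta> k f x t absolutely_integrable_on {t..b $ k}"
    and "((\<lambda>t. integral {t..b $ k} (right_RL_integrand \<beta> k f x t)) has_real_derivative
       - (Gamma (1 - \<beta>) * right_RL_deriv a b \<beta> k f (coord_update x k t))) (at t)"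
proof -
  have "coord_update x k t \<in> box a b" using x t by (auto simp: mem_box_cart)
  then have "has_right_RL_deriv a b \<beta> k f (coord_update x k t)"
    using f by blast
  then have 1: "right_RL_integrand \<beta> k f x t absolutely_integrable_on {t..b $ k}"
    and 2: "(\<lambda>t. integral {t..b $ k} (right_RL_integrand \<beta> k f x t)) differentiable (at t within {a $ k..b $ k})"
    by (simp_all add: has_right_RL_deriv_def)
  show "right_RL_integrand \<beta> k f x t absolutely_integrable_on {t..b $ k}" by (rule 1)
  have at: "at t within {a $ k..b $ k} = at t"
    using t by (intro at_within_Icc_at) auto
  have "0 < Gamma (1 - \<beta>)" using \<beta> by (intro Gamma_real_pos) simp
  then have "Gamma (1 - \<beta>) \<noteq> 0" by simp
  then show "((\<lambda>t. integral {t..b $ k} (right_RL_integrand \<beta> k f x t)) has_real_derivative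
       - (Gamma (1 - \<beta>) * right_RL_deriv a b \<beta> k f (coord_update x k t))) (at t)"
    using 2 by (simp add: right_RL_deriv_def vector_derivative_works at has_real_derivative_iff_has_vector_derivative)
qed

text \<open>On each line in direction \<open>k\<close> the restriction of \<open>f\<close> solves
  Abel's equation. The resulting bound involves only the maximum of the derivative and the side
  length, so the same \<open>K\<close> serves every line; measurability of \<open>f\<close> then
  allows the exceptional null sets on the lines to be put together.\<close>

lemma AE_bounded_if_continuous_left_RL_deriv:
  fixes f :: "real ^ 'n \<Rightarrow> real"
  assumes \<beta>: "0 < \<beta>" "\<beta> < 1" and ab: "\<And>i. a $ i < b $ i"
    and meas: "f \<in> borel_measurable (lebesgue_on (cbox a b))"
    and f: "\<And>x. x \<in> cbox a b \<Longrightarrow> has_left_RL_deriv a b \<beta> k f x"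
    and cont: "continuous_on (cbox a b) (left_RL_deriv a b \<beta> k f)"
  obtains K where "AE x in lebesgue. x \<in> cbox a b \<longrightarrow> \<bar>f x\<bar> \<le> K"
proof -
  have "compact (left_RL_deriv a b \<beta> k f ` cbox a b)"
    using cont by (intro compact_continuous_image) auto
  then obtain M where M: "\<And>x. x \<in> cbox a b \<Longrightarrow> \<bar>left_RL_deriv a b \<beta> k f x\<bar> \<le> M"
    using bounded_iff compact_imp_bounded by (metis imageI real_norm_def)
  have G: "0 < Gamma (1 - \<beta>)" using \<beta> by (simp add: Gamma_real_pos)
  define K where "K = Gamma (1 - \<beta>) * M * ((b $ k - a $ k) powr \<beta> / \<beta>) / Beta (1 - \<beta>) \<beta>"
  let ?N = "{x \<in> cbox a b. \<not> \<bar>f x\<bar> \<le> K}"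
  have "{x \<in> space (lebesgue_on (cbox a b)). \<not> \<bar>f x\<bar> \<le> K} \<in> sets (lebesgue_on (cbox a b))"
    using meas by measurable
  then have N: "?N \<in> sets lebesgue" by (subst (asm) sets_restrict_space_iff) auto
  have "AE x in lebesgue. x \<notin> ?N"
  proof (rule AE_if_AE_along_coordinate[OF N])
    fix y
    show "AE t in lebesgue. coord_update y k t \<notin> ?N"
    proof (cases "\<exists>t. coord_update y k t \<in> cbox a b")
      case True
      then obtain r where x: "coord_update y k r \<in> cbox a b" by blast
      have "AE t in lebesgue. t \<in> {a $ k..b $ k} \<longrightarrow> \<bar>f (coord_update y k t)\<bar> \<le> K"
        unfolding K_def
      proof (rule abel_equation_bounded[OF \<beta> ab])
        fix t assume t: "t \<in> {a $ k..b $ k}"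
        have *: "left_RL_integrand \<beta> k f y t = (\<lambda>s. (t - s) powr (- \<beta>) * f (coord_update y k s))" for t
          by (simp add: left_RL_integrand_def fun_eq_iff)
        note D = has_left_RL_derivD[OF \<beta>(2) x f t, unfolded left_RL_integrand_coord_update coord_update_coord_update *]
        show "(\<lambda>s. (t - s) powr (- \<beta>) * f (coord_update y k s)) absolutely_integrable_on {a $ k..t}"
          "((\<lambda>t. integral {a $ k..t} (\<lambda>s. (t - s) powr (- \<beta>) * f (coord_update y k s))) has_vector_derivative
            Gamma (1 - \<beta>) * left_RL_deriv a b \<beta> k f (coord_update y k t)) (at t within {a $ k..b $ k})"
          using D by auto
        have "coord_update y k t \<in> cbox a b"
          using coord_update_mem_cbox[OF x t] by simp
        then show "\<bar>Gamma (1 - \<beta>) * left_RL_deriv a b \<beta> k f (coord_update y k t)\<bar> \<le> Gamma (1 - \<beta>) * M"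
          using M G by (simp add: abs_mult)
      next
        have "continuous_on {a $ k..b $ k} (\<lambda>t. coord_update y k t)"
          unfolding coord_update_eq by (intro continuous_intros)
        then show "continuous_on {a $ k..b $ k} (\<lambda>t. Gamma (1 - \<beta>) * left_RL_deriv a b \<beta> k f (coord_update y k t))"
          using coord_update_mem_cbox[OF x, where k = k]
          by (intro continuous_intros continuous_on_compose2[OF cont]) auto
      qed
      then show ?thesis
        by eventually_elim (auto simp: mem_box_cart dest!: spec[of _ k])
    next
      case False
      then show ?thesis by auto
    qed
  qed
  then show ?thesis using that[of K] by (auto elim: eventually_mono)
qed

section \<open>Test functions\<close>

lemma has_real_derivative_max_0_power2:
  "((\<lambda>m. (max 0 m)\<^sup>2) has_real_derivative 2 * max 0 m) (at m)" for m :: real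
proof -
  consider "0 < m" | "m < 0" | "m = 0" by linarith
  then show ?thesis
  proof cases
    case 1
    have "((\<lambda>m. m\<^sup>2) has_real_derivative 2 * max 0 m) (at m)"
      using 1 by (auto intro!: derivative_eq_intros)
    then show ?thesis
      by (rule has_field_derivative_transform_within_open[where S = "{0<..}"]) (use 1 in auto)
  next
    case 2
    have "((\<lambda>m. 0) has_real_derivative 2 * max 0 m) (at m)"
      using 2 by (auto intro!: derivative_eq_intros)
    then show ?thesis
      by (rule has_field_derivative_transform_within_open[where S = "{..<0}"]) (use 2 in auto)
  next
    case 3
    have "((\<lambda>h::real. (max 0 h)\<^sup>2 / h) \<longlongrightarrow> 0) (at 0)"
    proof (rule Lim_null_comparison)
      show "\<forall>\<^sub>F h in at 0. norm ((max 0 h)\<^sup>2 / h) \<le> \<bar>h\<bar>"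
        by (intro always_eventually) (auto simp: max_def power2_eq_square)
      show "((\<lambda>h::real. \<bar>h\<bar>) \<longlongrightarrow> 0) (at 0)"
        by (rule tendsto_rabs_zero) (rule tendsto_ident_at)
    qed
    then show ?thesis using 3 by (simp add: has_field_derivative_iff)
  qed
qed

text \<open>The squared positive part makes the bump \<open>C\<^sup>1\<close> at \<open>c\<close> and \<open>d\<close>; the exponential makes it tend to the indicator as \<open>n\<close> grows.\<close>

definition bump :: "real \<Rightarrow> real \<Rightarrow> real \<Rightarrow> real \<Rightarrow> real" where
  "bump n c d t = 1 - exp (- (n * (max 0 ((t - c) * (d - t)))\<^sup>2))"

definition bump_deriv :: "real \<Rightarrow> real \<Rightarrow> real \<Rightarrow> real \<Rightarrow> real" where
  "bump_deriv n c d t = n * (2 * max 0 ((t - c) * (d - t)) * (c + d - 2 * t)) *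
     exp (- (n * (max 0 ((t - c) * (d - t)))\<^sup>2))"

lemma has_real_derivative_bump: "(bump n c d has_real_derivative bump_deriv n c d t) (at t)"
proof -
  have "((\<lambda>t. (t - c) * (d - t)) has_real_derivative (c + d - 2 * t)) (at t)"
    by (auto intro!: derivative_eq_intros simp: algebra_simps)
  from DERIV_chain2[OF has_real_derivative_max_0_power2 this]
  have *: "((\<lambda>t. (max 0 ((t - c) * (d - t)))\<^sup>2) has_real_derivative 2 * max 0 ((t - c) * (d - t)) * (c + d - 2 * t)) (at t)" .
  show ?thesis
    unfolding bump_def[abs_def] bump_deriv_def
    by (rule derivative_eq_intros * refl | simp)+
qed

lemma max_0_product_eq_0:
  assumes "c \<le> d" "t \<notin> {c<..<d}"
  shows "max 0 ((t - c) * (d - t)) = (0::real)"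
proof -
  have "(t - c) * (d - t) \<le> 0"
    using assms by (cases "t \<le> c") (auto intro: mult_nonpos_nonneg mult_nonneg_nonpos)
  then show ?thesis by simp
qed

lemma bump_eq_0: "c \<le> d \<Longrightarrow> t \<notin> {c<..<d} \<Longrightarrow> bump n c d t = 0"
  using max_0_product_eq_0[of c d t] by (simp add: bump_def)

lemma bump_deriv_eq_0: "c \<le> d \<Longrightarrow> t \<notin> {c<..<d} \<Longrightarrow> bump_deriv n c d t = 0"
  using max_0_product_eq_0[of c d t] by (simp add: bump_deriv_def)

lemma abs_bump_le_1: "0 \<le> n \<Longrightarrow> \<bar>bump n c d t\<bar> \<le> 1"
proof -
  assume "0 \<le> n"
  then have "exp (- (n * (max 0 ((t - c) * (d - t)))\<^sup>2)) \<le> 1"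
    by (simp only: exp_le_one_iff neg_le_0_iff_le mult_nonneg_nonneg zero_le_power2)
  moreover have "0 < exp (- (n * (max 0 ((t - c) * (d - t)))\<^sup>2))" by (rule exp_gt_zero)
  ultimately show ?thesis unfolding bump_def by linarith
qed

lemma continuous_on_bump_deriv: "continuous_on A (bump_deriv n c d)"
  unfolding bump_deriv_def by (intro continuous_intros)

lemma bump_deriv_bounded:
  assumes "c \<le> d"
  obtains M where "\<And>t. \<bar>bump_deriv n c d t\<bar> \<le> M"
proof -
  have "compact (bump_deriv n c d ` {c..d})"
    by (intro compact_continuous_image continuous_on_bump_deriv) auto
  then obtain M where M: "\<And>t. t \<in> {c..d} \<Longrightarrow> \<bar>bump_deriv n c d t\<bar> \<le> M"
    using bounded_iff compact_imp_bounded by (metis imageI real_norm_def)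
  have "\<bar>bump_deriv n c d t\<bar> \<le> max 0 M" for t
    using M[of t] bump_deriv_eq_0[OF assms, of t n] by (cases "t \<in> {c<..<d}") auto
  then show ?thesis using that by blast
qed

text \<open>At an interior point the squared product tends to a positive limit, so \<open>n\<close>
  times it tends to infinity. The supports are allowed to vary with \<open>n\<close> because a
  target interval may reach the ends of the side of the box, where a test function must
  vanish.\<close>

lemma tendsto_bump:
  assumes cd: "c < d"
    and C: "\<And>n. c \<le> C n" "C \<longlonglongrightarrow> c" and D: "\<And>n. D n \<le> d" "D \<longlonglongrightarrow> d" and CD: "\<And>n. C n \<le> D n"
  shows "(\<lambda>n. bump (real n) (C n) (D n) t) \<longlonglongrightarrow> indicator {c<..<d} t"
proof (cases "t \<in> {c<..<d}")
  case True
  let ?m = "\<lambda>n. (max 0 ((t - C n) * (D n - t)))\<^sup>2"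
  have "?m \<longlonglongrightarrow> (max 0 ((t - c) * (d - t)))\<^sup>2"
    by (intro tendsto_intros C D)
  moreover have "0 < (max 0 ((t - c) * (d - t)))\<^sup>2" using True by (auto simp: max_def not_le)
  ultimately have "filterlim (\<lambda>n. ?m n * real n) at_top sequentially"
    by (rule filterlim_tendsto_pos_mult_at_top) (rule filterlim_real_sequentially)
  then have "filterlim (\<lambda>n. - (real n * ?m n)) at_bot sequentially"
    by (simp add: filterlim_uminus_at_bot mult.commute)
  then have "(\<lambda>n. exp (- (real n * ?m n))) \<longlonglongrightarrow> 0"
    by (rule filterlim_compose[OF exp_at_bot])
  then have "(\<lambda>n. 1 - exp (- (real n * ?m n))) \<longlonglongrightarrow> 1 - 0"
    by (intro tendsto_intros)
  then show ?thesis using True by (simp add: bump_def)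
next
  case False
  have "bump (real n) (C n) (D n) t = 0" for n
  proof (rule bump_eq_0[OF CD])
    show "t \<notin> {C n<..<D n}" using False C(1)[of n] D(1)[of n] by auto
  qed
  then show ?thesis using False by simp
qed

text \<open>The strict inequalities keep the support off the faces, so adding a multiple of the
  product preserves the boundary values. The common bound 1 on the factors later provides a
  dominating function independent of the test function.\<close>

locale test_product =
  fixes a b c d :: "real ^ 'n" and \<alpha> :: "real ^ 'n" and h h' :: "'n \<Rightarrow> real \<Rightarrow> real"
  assumes alpha: "0 < \<alpha> $ i" "\<alpha> $ i < 1"
    and inner: "a $ i < c $ i" "c $ i \<le> d $ i" "d $ i < b $ i"
    and deriv: "(h i has_real_derivative h' i t) (at t)"
    and h_bounded: "\<bar>h i t\<bar> \<le> 1"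
    and support: "t \<notin> {c $ i<..<d $ i} \<Longrightarrow> h i t = 0" "t \<notin> {c $ i<..<d $ i} \<Longrightarrow> h' i t = 0"
    and h'_continuous: "continuous_on UNIV (h' i)"
    and h'_bounded: "\<exists>M. \<forall>t. \<bar>h' i t\<bar> \<le> M"
begin

definition eta :: "real ^ 'n \<Rightarrow> real" where
  "eta x = (\<Prod>i\<in>UNIV. h i (x $ i))"

definition cofactor :: "'n \<Rightarrow> real ^ 'n \<Rightarrow> real" where
  "cofactor k x = (\<Prod>i\<in>UNIV - {k}. h i (x $ i))"

text \<open>Closed form of the left derivative of \<open>eta\<close> in direction \<open>k\<close>,
  from which continuity up to the faces can be read off. It need not vanish for \<open>x $ k\<close>
  beyond \<open>d $ k\<close>.\<close>

definition Deta :: "'n \<Rightarrow> real ^ 'n \<Rightarrow> real" where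
  "Deta k x = cofactor k x * abel_transform (\<alpha> $ k) (h' k) (x $ k) / Gamma (1 - \<alpha> $ k)"

lemma a_less_b: "a $ i < b $ i"
  using inner[of i] by linarith

lemma h_continuous: "continuous_on A (h i)"
  by (intro continuous_at_imp_continuous_on ballI DERIV_isCont[OF deriv])

lemma eta_eq_cofactor: "eta x = h k (x $ k) * cofactor k x"
  unfolding eta_def cofactor_def by (subst prod.remove[of UNIV k]) auto

lemma cofactor_coord_update [simp]: "cofactor k (coord_update x k s) = cofactor k x"
  unfolding cofactor_def by (intro prod.cong) auto

lemma eta_coord_update: "eta (coord_update x k s) = h k s * cofactor k x"
  by (simp add: eta_eq_cofactor[where k = k])

lemma abs_eta_le_1: "\<bar>eta x\<bar> \<le> 1"
  unfolding eta_def abs_prod by (intro prod_le_1) (auto simp: h_bounded)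

lemma eta_continuous: "continuous_on A eta"
  unfolding eta_def
  by (intro continuous_on_prod continuous_on_compose2[OF h_continuous[of UNIV]] continuous_intros) auto

lemma eta_eq_0:
  assumes "x \<notin> box a b"
  shows "eta x = 0"
proof -
  obtain i where "x $ i \<notin> {a $ i<..<b $ i}" using assms by (auto simp: mem_box_cart)
  then have "h i (x $ i) = 0" using inner[of i] by (intro support) auto
  then show ?thesis unfolding eta_def by (auto intro: prod_zero)
qed

lemma support_left: "t \<le> c $ i \<Longrightarrow> h i t = 0" "t \<le> c $ i \<Longrightarrow> h' i t = 0"
  using support[where i = i and t = t] by auto

lemma left_RL_integrand_eta:
  "left_RL_integrand (\<alpha> $ k) k eta x t = (\<lambda>s. cofactor k x * ((t - s) powr (- (\<alpha> $ k)) * h k s))"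
  by (simp add: left_RL_integrand_def fun_eq_iff eta_coord_update)

lemma
  assumes x: "x \<in> cbox a b"
  shows has_left_RL_deriv_eta: "has_left_RL_deriv a b (\<alpha> $ k) k eta x"
    and left_RL_deriv_eta: "left_RL_deriv a b (\<alpha> $ k) k eta x = Deta k x"
proof -
  obtain M where M: "\<And>t. \<bar>h' k t\<bar> \<le> M" using h'_bounded by blast
  have ac: "a $ k \<le> c $ k" using inner[of k] by simp
  have integral: "integral {a $ k..t} (left_RL_integrand (\<alpha> $ k) k eta x t) = cofactor k x * abel_transform (\<alpha> $ k) (h k) t" for t
    unfolding left_RL_integrand_eta
    using abel_transform_eq_integral[OF alpha(2) h_continuous h_bounded support_left(1) ac]
    by simp
  have D: "(abel_transform (\<alpha> $ k) (h k) has_real_derivative abel_transform (\<alpha> $ k) (h' k) t) (at t)" for t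
    by (rule has_real_derivative_abel_transform[OF alpha(2) deriv h_bounded support_left(1) h'_continuous M support_left(2)])
  have 1: "left_RL_integrand (\<alpha> $ k) k eta x (x $ k) absolutely_integrable_on {a $ k..x $ k}"
    unfolding left_RL_integrand_eta
    using abel_transform_absolutely_integrable[OF alpha(2) h_continuous h_bounded support_left(1) ac]
    by (intro set_integrable_mult_right) blast
  have 2: "((\<lambda>t. integral {a $ k..t} (left_RL_integrand (\<alpha> $ k) k eta x t)) has_vector_derivative
      cofactor k x * abel_transform (\<alpha> $ k) (h' k) (x $ k)) (at (x $ k) within {a $ k..b $ k})"
    unfolding integral has_real_derivative_iff_has_vector_derivative[symmetric]
    by (rule DERIV_cmult[OF has_field_derivative_at_within[OF D]])
  show "has_left_RL_deriv a b (\<alpha> $ k) k eta x" "left_RL_deriv a b (\<alpha> $ k) k eta x = Deta k x"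
    using left_RL_derivI[OF alpha(2) x a_less_b 1 2] by (simp_all add: Deta_def)
qed

lemma Deta_continuous: "continuous_on (cbox a b) (Deta k)"
proof -
  obtain M where M: "\<And>t. \<bar>h' k t\<bar> \<le> M" using h'_bounded by blast
  have "continuous_on {..b $ k} (abel_transform (\<alpha> $ k) (h' k))"
    by (rule continuous_on_abel_transform[OF alpha(2) h'_continuous M support_left(2)])
  then have "continuous_on (cbox a b) (\<lambda>x. abel_transform (\<alpha> $ k) (h' k) (x $ k))"
    by (rule continuous_on_compose2) (auto simp: mem_box_cart intro!: continuous_intros)
  moreover have "continuous_on (cbox a b) (cofactor k)"
    unfolding cofactor_def
    by (intro continuous_on_prod continuous_on_compose2[OF h_continuous[of UNIV]] continuous_intros) auto
  moreover have "Gamma (1 - \<alpha> $ k) \<noteq> 0"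
    using Gamma_real_pos[of "1 - \<alpha> $ k"] alpha(2)[of k] by linarith
  ultimately show ?thesis
    unfolding Deta_def by (intro continuous_intros) auto
qed

end

section \<open>The first variation\<close>

lemma integrable_continuous_compose_AE_bounded:
  fixes U :: "'a::euclidean_space \<Rightarrow> 'b::euclidean_space" and f :: "'b \<Rightarrow> real"
  assumes S: "S \<in> lmeasurable" and U: "U \<in> borel_measurable (lebesgue_on S)"
    and R: "AE x in lebesgue_on S. norm (U x) \<le> R" and f: "continuous_on UNIV f"
  shows "integrable (lebesgue_on S) (\<lambda>x. f (U x))"
proof -
  have "compact (f ` cball 0 R)"
    using f by (intro compact_continuous_image continuous_on_subset[OF f]) auto
  then obtain B where B: "\<And>z. z \<in> cball 0 R \<Longrightarrow> \<bar>f z\<bar> \<le> B"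
    using bounded_iff compact_imp_bounded by (metis imageI real_norm_def)
  have "f \<in> borel_measurable borel" using f by (rule borel_measurable_continuous_onI)
  then have "(\<lambda>x. f (U x)) \<in> borel_measurable (lebesgue_on S)"
    using U by measurable
  moreover have "AE x in lebesgue_on S. norm (f (U x)) \<le> B"
    using R by eventually_elim (simp add: B)
  ultimately show ?thesis
    by (intro finite_measure.integrable_const_bound[OF finite_measure_lebesgue_on[OF S]])
qed

text \<open>\<open>L\<close> is Lipschitz on bounded sets only. The bounds on \<open>U\<close> and
  \<open>V\<close> keep all segments with \<open>\<bar>\<epsilon>\<bar> \<le> 1\<close> in one ball,
  on which \<open>DL\<close> is bounded by \<open>B\<close>, and so the difference quotients by
  \<open>B\<close> times \<open>R'\<close>. This is where the essential bound on a minimizer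
  enters.\<close>

lemma has_real_derivative_integral_variation:
  fixes U V :: "'a::euclidean_space \<Rightarrow> 'b::euclidean_space" and L :: "'b \<Rightarrow> real"
  assumes S: "S \<in> lmeasurable"
    and U: "U \<in> borel_measurable (lebesgue_on S)" "AE x in lebesgue_on S. norm (U x) \<le> R"
    and V: "V \<in> borel_measurable (lebesgue_on S)" "\<And>x. x \<in> S \<Longrightarrow> norm (V x) \<le> R'"
    and DL: "\<And>z. (L has_derivative blinfun_apply (DL z)) (at z)" "continuous_on UNIV DL"
  shows "((\<lambda>\<epsilon>. LINT x|lebesgue_on S. L (U x + \<epsilon> *\<^sub>R V x)) has_real_derivative
    (LINT x|lebesgue_on S. blinfun_apply (DL (U x)) (V x))) (at 0)"
proof -
  have VS: "AE x in lebesgue_on S. norm (V x) \<le> \<bar>R'\<bar>"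
    using V(2) by (intro AE_I2) (fastforce intro: order_trans[OF V(2) abs_ge_self])
  have cont: "continuous_on UNIV L"
    by (rule continuous_at_imp_continuous_on) (use DL(1) has_derivative_continuous in blast)
  let ?R = "R + \<bar>R'\<bar>"
  have "compact (DL ` cball 0 ?R)"
    by (intro compact_continuous_image continuous_on_subset[OF DL(2)]) auto
  then obtain B where B: "\<And>z. z \<in> cball 0 ?R \<Longrightarrow> norm (DL z) \<le> B"
    using bounded_iff compact_imp_bounded by (metis imageI)
  have lip: "\<bar>L z - L w\<bar> \<le> B * norm (z - w)" if "z \<in> cball 0 ?R" "w \<in> cball 0 ?R" for z w
  proof -
    have "norm (L z - L w) \<le> B * norm (z - w)"
    proof (rule differentiable_bound[of "cball 0 ?R" L "\<lambda>z. blinfun_apply (DL z)"])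
      show "(L has_derivative blinfun_apply (DL x)) (at x within cball 0 ?R)" for x
        using DL(1) by (rule has_derivative_at_withinI)
      show "onorm (blinfun_apply (DL x)) \<le> B" if "x \<in> cball 0 ?R" for x
        using B[OF that] by (simp add: norm_blinfun.rep_eq)
    qed (use that in auto)
    then show ?thesis by simp
  qed
  have ball: "AE x in lebesgue_on S. U x + \<epsilon> *\<^sub>R V x \<in> cball 0 ?R" if "\<bar>\<epsilon>\<bar> \<le> 1" for \<epsilon>
    using U(2) VS
  proof eventually_elim
    case (elim x)
    have "norm (\<epsilon> *\<^sub>R V x) \<le> 1 * norm (V x)"
      unfolding norm_scaleR using that by (intro mult_right_mono) auto
    then have "norm (U x + \<epsilon> *\<^sub>R V x) \<le> ?R"
      using elim norm_triangle_ineq[of "U x" "\<epsilon> *\<^sub>R V x"] by linarith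
    then show ?case by simp
  qed
  have "((\<lambda>\<epsilon>. LINT x|lebesgue_on S. L (U x + \<epsilon> *\<^sub>R V x)) has_real_derivative
    (LINT x|lebesgue_on S. blinfun_apply (DL (U x)) (V x))) (at 0)"
  proof (rule has_real_derivative_under_integral[where S = "{-1<..<1}" and w = "\<lambda>x. \<bar>B\<bar> * \<bar>R'\<bar>"])
    show "integrable (lebesgue_on S) (\<lambda>x. L (U x + \<epsilon> *\<^sub>R V x))" if "\<epsilon> \<in> {-1<..<1}" for \<epsilon>
    proof (rule integrable_continuous_compose_AE_bounded[OF S _ _ cont])
      show "(\<lambda>x. U x + \<epsilon> *\<^sub>R V x) \<in> borel_measurable (lebesgue_on S)"
        using U(1) V(1) by measurable
      show "AE x in lebesgue_on S. norm (U x + \<epsilon> *\<^sub>R V x) \<le> ?R"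
        using ball[of \<epsilon>] that by (auto simp: abs_le_iff)
    qed
    show "AE x in lebesgue_on S. ((\<lambda>\<epsilon>. L (U x + \<epsilon> *\<^sub>R V x)) has_real_derivative blinfun_apply (DL (U x)) (V x)) (at 0)"
    proof (intro AE_I2)
      fix x
      have "((\<lambda>\<epsilon>. U x + \<epsilon> *\<^sub>R V x) has_derivative (\<lambda>\<epsilon>. \<epsilon> *\<^sub>R V x)) (at 0)"
        by (auto intro!: derivative_eq_intros)
      moreover have "(L has_derivative blinfun_apply (DL (U x))) (at (U x + 0 *\<^sub>R V x))"
        using DL(1)[of "U x"] by simp
      ultimately have "((\<lambda>\<epsilon>. L (U x + \<epsilon> *\<^sub>R V x)) has_derivative (\<lambda>\<epsilon>. blinfun_apply (DL (U x)) (\<epsilon> *\<^sub>R V x))) (at 0)"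
        by (rule has_derivative_compose)
      then show "((\<lambda>\<epsilon>. L (U x + \<epsilon> *\<^sub>R V x)) has_real_derivative blinfun_apply (DL (U x)) (V x)) (at 0)"
        unfolding has_field_derivative_def by (simp add: blinfun.scaleR_right mult_commute_abs)
    qed
    show "(\<lambda>x. blinfun_apply (DL (U x)) (V x)) \<in> borel_measurable (lebesgue_on S)"
    proof (rule borel_measurable_continuous_Pair[OF U(1) V(1)])
      show "continuous_on UNIV (\<lambda>p. blinfun_apply (DL (fst p)) (snd p))"
        by (intro blinfun.continuous_on continuous_on_compose2[OF DL(2)] continuous_intros) auto
    qed
    show "integrable (lebesgue_on S) (\<lambda>x. \<bar>B\<bar> * \<bar>R'\<bar>)"
      using finite_measure_lebesgue_on[OF S] by (rule finite_measure.integrable_const)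
    show "AE x in lebesgue_on S. \<bar>L (U x + \<epsilon> *\<^sub>R V x) - L (U x + 0 *\<^sub>R V x)\<bar> \<le> \<bar>B\<bar> * \<bar>R'\<bar> * \<bar>\<epsilon> - 0\<bar>"
      if "\<epsilon> \<in> {-1<..<1}" for \<epsilon>
    proof -
      have e: "\<bar>\<epsilon>\<bar> \<le> 1" using that by auto
      show ?thesis
        using ball[OF e] ball[of 0, simplified] VS
      proof eventually_elim
        case (elim x)
        have "\<bar>L (U x + \<epsilon> *\<^sub>R V x) - L (U x)\<bar> \<le> B * norm (\<epsilon> *\<^sub>R V x)"
          using lip[of "U x + \<epsilon> *\<^sub>R V x" "U x"] elim by simp
        also have "\<dots> \<le> \<bar>B\<bar> * (\<bar>\<epsilon>\<bar> * \<bar>R'\<bar>)"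
          unfolding norm_scaleR using elim by (intro mult_mono) auto
        finally show ?case by (simp add: mult_ac)
      qed
    qed
  qed auto
  then show ?thesis .
qed

lemma
  fixes L :: "(real ^ 'm) \<times> (real ^ 'n ^ 'm) \<Rightarrow> real"
  assumes DL: "(L has_derivative blinfun_apply (DL z)) (at z)"
  shows partial_value_eq: "partial_value L j z = blinfun_apply (DL z) (axis j 1, 0)"
    and partial_grad_eq: "partial_grad L j i z = blinfun_apply (DL z) (0, axis j (axis i 1))"
proof -
  have *: "deriv (\<lambda>h. L (z + h *\<^sub>R w)) 0 = blinfun_apply (DL z) w" for w
  proof (rule DERIV_imp_deriv)
    have "((\<lambda>h. z + h *\<^sub>R w) has_derivative (\<lambda>h. h *\<^sub>R w)) (at 0)"
      by (auto intro!: derivative_eq_intros)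
    moreover have "(L has_derivative blinfun_apply (DL z)) (at (z + 0 *\<^sub>R w))"
      using DL by simp
    ultimately have "((\<lambda>h. L (z + h *\<^sub>R w)) has_derivative (\<lambda>h. blinfun_apply (DL z) (h *\<^sub>R w))) (at 0)"
      by (rule has_derivative_compose)
    then show "((\<lambda>h. L (z + h *\<^sub>R w)) has_real_derivative blinfun_apply (DL z) w) (at 0)"
      unfolding has_field_derivative_def by (simp add: blinfun.scaleR_right mult_commute_abs)
  qed
  have "(fst z + h *\<^sub>R axis j 1, snd z) = z + h *\<^sub>R (axis j 1, 0)" for h
    by (simp add: prod_eq_iff)
  then show "partial_value L j z = blinfun_apply (DL z) (axis j 1, 0)"
    unfolding partial_value_def by (simp only: *)
  have "(fst z, snd z + h *\<^sub>R axis j (axis i 1)) = z + h *\<^sub>R (0, axis j (axis i 1))" for h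
    by (simp add: prod_eq_iff)
  then show "partial_grad L j i z = blinfun_apply (DL z) (0, axis j (axis i 1))"
    unfolding partial_grad_def by (simp only: *)
qed

section \<open>Variations of admissible functions and of the action\<close>

lemma left_RL_deriv_add_mult:
  assumes \<beta>: "\<beta> < 1" and ab: "a $ k < b $ k" and x: "x \<in> cbox a b"
    and f: "\<And>x. x \<in> cbox a b \<Longrightarrow> has_left_RL_deriv a b \<beta> k f x"
    and g: "\<And>x. x \<in> cbox a b \<Longrightarrow> has_left_RL_deriv a b \<beta> k g x"
  shows "has_left_RL_deriv a b \<beta> k (\<lambda>y. f y + c * g y) x"
    and "left_RL_deriv a b \<beta> k (\<lambda>y. f y + c * g y) x = left_RL_deriv a b \<beta> k f x + c * left_RL_deriv a b \<beta> k g x"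
proof -
  have xk: "x $ k \<in> {a $ k..b $ k}" using x by (auto simp: mem_box_cart)
  have eq: "left_RL_integrand \<beta> k (\<lambda>y. f y + c * g y) x t = (\<lambda>s. left_RL_integrand \<beta> k f x t s + c * left_RL_integrand \<beta> k g x t s)" for t
    by (simp add: left_RL_integrand_def fun_eq_iff algebra_simps)
  note F = has_left_RL_derivD[OF \<beta> x f] and G = has_left_RL_derivD[OF \<beta> x g]
  have int: "integral {a $ k..t} (left_RL_integrand \<beta> k (\<lambda>y. f y + c * g y) x t) =
     integral {a $ k..t} (left_RL_integrand \<beta> k f x t) + c * integral {a $ k..t} (left_RL_integrand \<beta> k g x t)"
    if "t \<in> {a $ k..b $ k}" for t
    unfolding eq using F(1)[OF _ that] G(1)[OF _ that]
    by (subst Henstock_Kurzweil_Integration.integral_add) (auto simp: set_lebesgue_integral_eq_integral(1))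
  have 1: "left_RL_integrand \<beta> k (\<lambda>y. f y + c * g y) x (x $ k) absolutely_integrable_on {a $ k..x $ k}"
    unfolding eq using F(1)[OF _ xk] G(1)[OF _ xk] by (intro set_integral_add set_integrable_mult_right) auto
  have "((\<lambda>t. integral {a $ k..t} (left_RL_integrand \<beta> k f x t) + c * integral {a $ k..t} (left_RL_integrand \<beta> k g x t)) has_vector_derivative
      (Gamma (1 - \<beta>) * left_RL_deriv a b \<beta> k f (coord_update x k (x $ k)) + c * (Gamma (1 - \<beta>) * left_RL_deriv a b \<beta> k g (coord_update x k (x $ k)))))
      (at (x $ k) within {a $ k..b $ k})"
    using F(2)[OF _ xk] G(2)[OF _ xk] by (intro has_vector_derivative_add has_vector_derivative_mult_right) auto
  then have 2: "((\<lambda>t. integral {a $ k..t} (left_RL_integrand \<beta> k (\<lambda>y. f y + c * g y) x t)) has_vector_derivative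
      (Gamma (1 - \<beta>) * left_RL_deriv a b \<beta> k f x + c * (Gamma (1 - \<beta>) * left_RL_deriv a b \<beta> k g x)))
      (at (x $ k) within {a $ k..b $ k})"
    by (intro has_vector_derivative_transform[OF xk int]) simp_all
  have "0 < Gamma (1 - \<beta>)" using \<beta> by (intro Gamma_real_pos) simp
  then have "Gamma (1 - \<beta>) \<noteq> 0" by simp
  then have "(Gamma (1 - \<beta>) * A + c * (Gamma (1 - \<beta>) * B)) / Gamma (1 - \<beta>) = A + c * B" for A B :: real
    by (simp add: field_simps)
  then show "left_RL_deriv a b \<beta> k (\<lambda>y. f y + c * g y) x = left_RL_deriv a b \<beta> k f x + c * left_RL_deriv a b \<beta> k g x"
    using left_RL_derivI(2)[OF \<beta> x ab 1 2] by simp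
  show "has_left_RL_deriv a b \<beta> k (\<lambda>y. f y + c * g y) x"
    by (rule left_RL_derivI(1)[OF \<beta> x ab 1 2])
qed

lemma frac_grad_continuous:
  assumes "admissible a b \<alpha> \<phi> u"
  shows "continuous_on (cbox a b) (frac_grad a b \<alpha> u)"
  using assms unfolding frac_grad_def[abs_def] admissible_def
  by (intro continuous_on_vec_lambda) auto

lemma admissible_measurable_Pair:
  fixes u :: "real ^ 'n \<Rightarrow> real ^ 'm"
  assumes "admissible a b \<alpha> \<phi> u"
  shows "(\<lambda>x. (u x, frac_grad a b \<alpha> u x)) \<in> borel_measurable (lebesgue_on (cbox a b))"
  using assms continuous_imp_measurable_on_sets_lebesgue[OF frac_grad_continuous[OF assms]]
  unfolding admissible_def by (intro borel_measurable_Pair) auto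

lemma admissible_AE_bounded:
  fixes u :: "real ^ 'n \<Rightarrow> real ^ 'm"
  assumes alpha: "\<And>i. 0 < \<alpha> $ i \<and> \<alpha> $ i < 1" and ab: "\<And>i. a $ i < b $ i"
    and u: "admissible a b \<alpha> \<phi> u"
  obtains R where "AE x in lebesgue_on (cbox a b). norm (u x, frac_grad a b \<alpha> u x) \<le> R"
proof -
  have "\<exists>K. AE x in lebesgue. x \<in> cbox a b \<longrightarrow> \<bar>u x $ j\<bar> \<le> K" for j
  proof -
    have "(\<lambda>x. u x $ j) \<in> borel_measurable (lebesgue_on (cbox a b))"
      using u unfolding admissible_def
      by (intro borel_measurable_continuous_on[where f = "\<lambda>v. v $ j"] continuous_intros) auto
    \<comment> \<open>A single coordinate direction is enough for the bound;
      \<open>undefined\<close> stands for an arbitrary one.\<close>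
    then show ?thesis
      using u alpha[of undefined] unfolding admissible_def
      by (elim conjE AE_bounded_if_continuous_left_RL_deriv[of "\<alpha> $ undefined" a b "\<lambda>x. u x $ j" undefined, OF _ _ ab]) auto
  qed
  then obtain K where K: "\<And>j. AE x in lebesgue. x \<in> cbox a b \<longrightarrow> \<bar>u x $ j\<bar> \<le> K j" by metis
  have ae: "AE x in lebesgue. \<forall>j\<in>UNIV. x \<in> cbox a b \<longrightarrow> \<bar>u x $ j\<bar> \<le> K j"
    using K by (intro AE_finite_allI) auto
  have "compact (frac_grad a b \<alpha> u ` cbox a b)"
    by (intro compact_continuous_image frac_grad_continuous[OF u]) auto
  then obtain M where M: "\<And>x. x \<in> cbox a b \<Longrightarrow> norm (frac_grad a b \<alpha> u x) \<le> M"
    using bounded_iff compact_imp_bounded by (metis imageI)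
  have "AE x in lebesgue. x \<in> cbox a b \<longrightarrow> norm (u x, frac_grad a b \<alpha> u x) \<le> (\<Sum>j\<in>UNIV. K j) + M"
    using ae
  proof eventually_elim
    case (elim x)
    show ?case
    proof
      assume x: "x \<in> cbox a b"
      have "norm (u x) \<le> (\<Sum>j\<in>UNIV. \<bar>u x $ j\<bar>)" by (rule norm_le_l1_cart)
      also have "\<dots> \<le> (\<Sum>j\<in>UNIV. K j)" using elim x by (intro sum_mono) auto
      finally show "norm (u x, frac_grad a b \<alpha> u x) \<le> (\<Sum>j\<in>UNIV. K j) + M"
        using M[OF x] norm_Pair_le[of "u x" "frac_grad a b \<alpha> u x"] by linarith
    qed
  qed
  then have "AE x in lebesgue_on (cbox a b). norm (u x, frac_grad a b \<alpha> u x) \<le> (\<Sum>j\<in>UNIV. K j) + M"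
    by (subst AE_restrict_space_iff) auto
  then show ?thesis by (rule that)
qed

lemma action_eq: "action a b \<alpha> L u = (LINT x|lebesgue_on (cbox a b). L (u x, frac_grad a b \<alpha> u x))"
  unfolding action_def set_lebesgue_integral_def by (subst integral_restrict_space) auto

context test_product
begin

lemma
  fixes u :: "real ^ 'n \<Rightarrow> real ^ 'm"
  assumes u: "admissible a b \<alpha> \<phi> u"
  shows admissible_variation: "admissible a b \<alpha> \<phi> (\<lambda>x. u x + (\<epsilon> * eta x) *\<^sub>R axis j 1)"
    and frac_grad_variation: "x \<in> cbox a b \<Longrightarrow> frac_grad a b \<alpha> (\<lambda>x. u x + (\<epsilon> * eta x) *\<^sub>R axis j 1) x =
      frac_grad a b \<alpha> u x + \<epsilon> *\<^sub>R (\<Sum>i\<in>UNIV. Deta i x *\<^sub>R axis j (axis i 1))"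
proof -
  let ?v = "\<lambda>x. u x + (\<epsilon> * eta x) *\<^sub>R axis j 1 :: real ^ 'm"
  \<comment> \<open>The factor \<open>axis j 1 $ j'\<close> is 1 or 0, so the varied component and
    the unchanged ones are handled together.\<close>
  have comp: "(\<lambda>y. ?v y $ j') = (\<lambda>y. u y $ j' + (\<epsilon> * axis j 1 $ j') * eta y)" for j'
    by (simp add: fun_eq_iff)
  have hu: "\<And>x. x \<in> cbox a b \<Longrightarrow> has_left_RL_deriv a b (\<alpha> $ i) i (\<lambda>y. u y $ j') x" for i j'
    using u by (auto simp: admissible_def)
  note add = left_RL_deriv_add_mult[OF alpha(2) a_less_b _ hu has_left_RL_deriv_eta]
  have has: "has_left_RL_deriv a b (\<alpha> $ i) i (\<lambda>y. ?v y $ j') x" if "x \<in> cbox a b" for i j' x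
    unfolding comp by (rule add(1)[OF that])
  have val: "left_RL_deriv a b (\<alpha> $ i) i (\<lambda>y. ?v y $ j') x =
     left_RL_deriv a b (\<alpha> $ i) i (\<lambda>y. u y $ j') x + (\<epsilon> * axis j 1 $ j') * Deta i x" if "x \<in> cbox a b" for i j' x
    unfolding comp by (subst add(2)[OF that]) (simp_all add: left_RL_deriv_eta[OF that])
  have sum: "(\<Sum>i\<in>UNIV. Deta i x *\<^sub>R axis j (axis i 1)) $ j' $ i' = axis j 1 $ j' * Deta i' x" for x j' i'
    by (simp add: axis_def if_distrib[of "\<lambda>v. v $ i'"] if_distrib cong: if_cong)
  show "frac_grad a b \<alpha> ?v x = frac_grad a b \<alpha> u x + \<epsilon> *\<^sub>R (\<Sum>i\<in>UNIV. Deta i x *\<^sub>R axis j (axis i 1))" if "x \<in> cbox a b"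
    unfolding vec_eq_iff
  proof (intro allI)
    fix j' i'
    show "frac_grad a b \<alpha> ?v x $ j' $ i' = (frac_grad a b \<alpha> u x + \<epsilon> *\<^sub>R (\<Sum>i\<in>UNIV. Deta i x *\<^sub>R axis j (axis i 1))) $ j' $ i'"
    proof -
      have "frac_grad a b \<alpha> ?v x $ j' $ i' = left_RL_deriv a b (\<alpha> $ i') i' (\<lambda>y. u y $ j') x + (\<epsilon> * axis j 1 $ j') * Deta i' x"
        unfolding frac_grad_def vec_lambda_beta by (rule val[OF that])
      moreover have "(frac_grad a b \<alpha> u x + \<epsilon> *\<^sub>R (\<Sum>i\<in>UNIV. Deta i x *\<^sub>R axis j (axis i 1))) $ j' $ i' =
          left_RL_deriv a b (\<alpha> $ i') i' (\<lambda>y. u y $ j') x + (\<epsilon> * axis j 1 $ j') * Deta i' x"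
        unfolding vector_add_component vector_scaleR_component sum frac_grad_def vec_lambda_beta by simp
      ultimately show ?thesis by (rule trans[OF _ sym])
    qed
  qed
  show "admissible a b \<alpha> \<phi> ?v"
    unfolding admissible_def
  proof (intro conjI allI ballI)
    have "eta \<in> borel_measurable (lebesgue_on (cbox a b))"
      by (rule continuous_imp_measurable_on_sets_lebesgue[OF eta_continuous]) auto
    then show "?v \<in> borel_measurable (lebesgue_on (cbox a b))"
      using u unfolding admissible_def by (intro borel_measurable_add borel_measurable_scaleR) auto
    show "has_left_RL_deriv a b (\<alpha> $ i) i (\<lambda>y. ?v y $ j') x" if "x \<in> cbox a b" for i j' x
      by (rule has[OF that])
    show "continuous_on (cbox a b) (left_RL_deriv a b (\<alpha> $ i) i (\<lambda>y. ?v y $ j'))" for i j'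
    proof -
      have "continuous_on (cbox a b) (\<lambda>x. left_RL_deriv a b (\<alpha> $ i) i (\<lambda>y. u y $ j') x + (\<epsilon> * axis j 1 $ j') * Deta i x)"
        using u unfolding admissible_def by (intro continuous_intros Deta_continuous) auto
      then show ?thesis
        using val continuous_on_cong[of "cbox a b" "cbox a b" "left_RL_deriv a b (\<alpha> $ i) i (\<lambda>y. ?v y $ j')"] by simp
    qed
    show "?v x = \<phi> x" if "x \<in> frontier (cbox a b)" for x
      using that u eta_eq_0[of x] by (auto simp: admissible_def frontier_cbox)
  qed
qed

text \<open>By linearity of the left derivative the pair of value and gradient moves along a
  straight segment in direction \<open>V\<close>, so differentiation under the integral applies and
  a minimum at 0 has zero derivative. Expanding \<open>V\<close> in unit vectors turns
  \<open>DL\<close> into the partial derivatives of \<open>L\<close>.\<close>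

lemma first_variation_zero:
  fixes L :: "(real ^ 'm) \<times> (real ^ 'n ^ 'm) \<Rightarrow> real"
  assumes DL: "\<And>z. (L has_derivative blinfun_apply (DL z)) (at z)" "continuous_on UNIV DL"
    and min: "minimizes_action a b \<alpha> L \<phi> u"
  shows "(LINT x|lebesgue_on (cbox a b). eta x * partial_value L j (u x, frac_grad a b \<alpha> u x)
     + (\<Sum>i\<in>UNIV. Deta i x * momentum a b \<alpha> L u j i x)) = 0"
proof -
  have u: "admissible a b \<alpha> \<phi> u" using min by (simp add: minimizes_action_def)
  define U where "U x = (u x, frac_grad a b \<alpha> u x)" for x
  define V where "V x = (eta x *\<^sub>R axis j 1 :: real ^ 'm, (\<Sum>i\<in>UNIV. Deta i x *\<^sub>R axis j (axis i 1)) :: real ^ 'n ^ 'm)" for x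
  obtain R where R: "AE x in lebesgue_on (cbox a b). norm (U x) \<le> R"
    using admissible_AE_bounded[OF _ a_less_b u] alpha unfolding U_def by blast
  have Vc: "continuous_on (cbox a b) V"
    unfolding V_def by (intro continuous_intros eta_continuous Deta_continuous)
  then have "compact (V ` cbox a b)" by (rule compact_continuous_image) auto
  then obtain R' where R': "\<And>x. x \<in> cbox a b \<Longrightarrow> norm (V x) \<le> R'"
    using bounded_iff compact_imp_bounded by (metis imageI)
  have Um: "U \<in> borel_measurable (lebesgue_on (cbox a b))"
    unfolding U_def by (rule admissible_measurable_Pair[OF u])
  have Vm: "V \<in> borel_measurable (lebesgue_on (cbox a b))"
    by (rule continuous_imp_measurable_on_sets_lebesgue[OF Vc]) auto
  define J where "J \<epsilon> = (LINT x|lebesgue_on (cbox a b). L (U x + \<epsilon> *\<^sub>R V x))" for \<epsilon>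
  have D: "(J has_real_derivative (LINT x|lebesgue_on (cbox a b). blinfun_apply (DL (U x)) (V x))) (at 0)"
    unfolding J_def by (rule has_real_derivative_integral_variation[OF _ Um R Vm R' DL]) auto
  have J: "J \<epsilon> = action a b \<alpha> L (\<lambda>x. u x + (\<epsilon> * eta x) *\<^sub>R axis j 1)" for \<epsilon>
    unfolding J_def action_eq
    by (rule Bochner_Integration.integral_cong)
      (auto simp: U_def V_def frac_grad_variation[OF u])
  have "J 0 \<le> J \<epsilon>" for \<epsilon>
  proof -
    have "J 0 = action a b \<alpha> L u" unfolding J by simp
    also have "\<dots> \<le> J \<epsilon>"
      using min admissible_variation[OF u] unfolding J minimizes_action_def by blast
    finally show ?thesis .
  qed
  then have "(LINT x|lebesgue_on (cbox a b). blinfun_apply (DL (U x)) (V x)) = 0"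
    using DERIV_local_min[OF D, of 1] by simp
  moreover have "blinfun_apply (DL (U x)) (V x) = eta x * partial_value L j (U x) + (\<Sum>i\<in>UNIV. Deta i x * momentum a b \<alpha> L u j i x)" for x
  proof -
    have "V x = eta x *\<^sub>R (axis j 1, 0) + (\<Sum>i\<in>UNIV. Deta i x *\<^sub>R (0, axis j (axis i 1)))"
      by (simp add: V_def prod_eq_iff fst_sum snd_sum)
    then have "blinfun_apply (DL (U x)) (V x) = eta x * blinfun_apply (DL (U x)) (axis j 1, 0) + (\<Sum>i\<in>UNIV. Deta i x * blinfun_apply (DL (U x)) (0, axis j (axis i 1)))"
      by (simp only: blinfun.add_right blinfun.scaleR_right blinfun.sum_right real_scaleR_def)
    then show ?thesis
      by (simp only: partial_value_eq[where DL = DL, OF DL(1)] partial_grad_eq[where DL = DL, OF DL(1)] momentum_def U_def)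
  qed
  ultimately show ?thesis by (simp add: U_def)
qed

end

section \<open>The Euler--Lagrange equation\<close>

lemma absolutely_integrable_continuous_mult:
  fixes f g :: "'a::euclidean_space \<Rightarrow> real"
  assumes f: "continuous_on (cbox a b) f" and g: "g absolutely_integrable_on cbox a b"
  shows "(\<lambda>x. f x * g x) absolutely_integrable_on cbox a b"
proof (rule absolutely_integrable_bounded_measurable_product[OF bilinear_times _ _ _ g])
  show "f \<in> borel_measurable (lebesgue_on (cbox a b))"
    by (rule continuous_imp_measurable_on_sets_lebesgue[OF f]) auto
  show "bounded (f ` cbox a b)"
    by (intro compact_imp_bounded compact_continuous_image f) auto
qed auto

lemma absolutely_integrable_on_iff_lebesgue_on:
  "S \<in> sets lebesgue \<Longrightarrow> f absolutely_integrable_on S \<longleftrightarrow> integrable (lebesgue_on S) f"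
  unfolding set_integrable_def by (subst integrable_restrict_space) auto

context test_product
begin

text \<open>Along the line, \<open>eta\<close> and \<open>Deta k\<close> are the constant
  \<open>cofactor k y\<close> times one-dimensional functions, so the formula on an interval
  applies. Lines that miss the open box contribute nothing.\<close>

lemma fractional_integration_by_parts_along_coordinate:
  fixes p :: "real ^ 'n \<Rightarrow> real" and k :: 'n
  defines "Q \<equiv> right_RL_deriv a b (\<alpha> $ k) k p"
  assumes p: "\<And>x. x \<in> box a b \<Longrightarrow> has_right_RL_deriv a b (\<alpha> $ k) k p x"
    and Q: "continuous_on (box a b) Q"
  shows "has_bochner_integral lebesgue
    (\<lambda>t. indicator (box a b) (coord_update y k t) *
      (Deta k (coord_update y k t) * p (coord_update y k t) - eta (coord_update y k t) * Q (coord_update y k t))) 0"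
proof (cases "\<exists>t. coord_update y k t \<in> box a b")
  case True
  then obtain r where x: "coord_update y k r \<in> box a b" by blast
  obtain M where M: "\<And>t. \<bar>h' k t\<bar> \<le> M" using h'_bounded by blast
  have other: "a $ i < y $ i \<and> y $ i < b $ i" if "i \<noteq> k" for i
    using x that by (auto simp: mem_box_cart dest!: spec[of _ i])
  have box: "coord_update y k t \<in> box a b \<longleftrightarrow> t \<in> {a $ k<..<b $ k}" for t
    using other by (auto simp: mem_box_cart)
  have ind: "indicator (box a b) (coord_update y k t) = (indicator {a $ k<..<b $ k} t :: real)" for t
    using box[of t] by (auto simp: indicator_def)
  define pl where "pl t = p (coord_update y k t)" for t
  \<comment> \<open>The derivative of the unnormalised right integral: its sign and Gamma factor
    come from the definition of the right derivative. The sign cancels that of integration by parts,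
    and the Gamma factor the one in \<open>Deta\<close>.\<close>
  define ql where "ql t = - (Gamma (1 - \<alpha> $ k) * Q (coord_update y k t))" for t
  have *: "right_RL_integrand (\<alpha> $ k) k p y t = (\<lambda>s. (s - t) powr (- (\<alpha> $ k)) * pl s)" for t
    by (simp add: right_RL_integrand_def fun_eq_iff pl_def)
  note D = has_right_RL_derivD[OF alpha(2) x p, unfolded right_RL_integrand_coord_update coord_update_coord_update *]
  have c: "continuous_on {a $ k<..<b $ k} ql"
  proof -
    have "continuous_on {a $ k<..<b $ k} (\<lambda>t. coord_update y k t)"
      unfolding coord_update_eq by (intro continuous_intros)
    then have "continuous_on {a $ k<..<b $ k} (\<lambda>t. Q (coord_update y k t))"
    proof (rule continuous_on_compose2[OF Q])
      show "(\<lambda>t. coord_update y k t) ` {a $ k<..<b $ k} \<subseteq> box a b"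
        by (rule image_subsetI) (simp only: box)
    qed
    then show ?thesis
      unfolding ql_def by (intro continuous_intros)
  qed
  have G: "0 < Gamma (1 - \<alpha> $ k)" using alpha(2)[of k] by (intro Gamma_real_pos) simp
  let ?A = "abel_transform (\<alpha> $ k) (h' k)"
  note P = fractional_integration_by_parts[OF alpha inner deriv support(1) h'_continuous M support(2) D(1), of ql]
  have 1: "integrable lebesgue (\<lambda>t. indicator {a $ k<..<b $ k} t * (pl t * ?A t))"
    and 2: "integrable lebesgue (\<lambda>t. indicator {a $ k<..<b $ k} t * (h k t * ql t))"
    and 3: "(LINT t|lebesgue. indicator {a $ k<..<b $ k} t * (pl t * ?A t)) =
      - (LINT t|lebesgue. indicator {a $ k<..<b $ k} t * (h k t * ql t))"
    using P D(2) c unfolding ql_def Q_def by auto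
  have eq: "indicator (box a b) (coord_update y k t) *
      (Deta k (coord_update y k t) * p (coord_update y k t) - eta (coord_update y k t) * Q (coord_update y k t))
     = cofactor k y / Gamma (1 - \<alpha> $ k) * (indicator {a $ k<..<b $ k} t * (pl t * ?A t) + indicator {a $ k<..<b $ k} t * (h k t * ql t))" for t
    unfolding ind Deta_def eta_coord_update cofactor_coord_update pl_def ql_def
    using G by (simp add: field_simps)
  have "has_bochner_integral lebesgue (\<lambda>t. cofactor k y / Gamma (1 - \<alpha> $ k) * (indicator {a $ k<..<b $ k} t * (pl t * ?A t) + indicator {a $ k<..<b $ k} t * (h k t * ql t)))
    (cofactor k y / Gamma (1 - \<alpha> $ k) * ((LINT t|lebesgue. indicator {a $ k<..<b $ k} t * (pl t * ?A t)) + (LINT t|lebesgue. indicator {a $ k<..<b $ k} t * (h k t * ql t))))"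
    by (intro has_bochner_integral_mult_right has_bochner_integral_add has_bochner_integral_integrable 1 2)
  then show ?thesis unfolding eq 3 by simp
next
  case False
  then have "(\<lambda>t. indicator (box a b) (coord_update y k t) *
      (Deta k (coord_update y k t) * p (coord_update y k t) - eta (coord_update y k t) * Q (coord_update y k t))) = (\<lambda>t. 0)"
    by (auto simp: fun_eq_iff)
  then show ?thesis by (simp add: has_bochner_integral_zero)
qed

text \<open>Both terms are kept in one integrand because then every line integral is zero, and it is
  zero line integrals that pass to the box. The work is done on the open box, where the right
  derivative is controlled; the faces are a null set.\<close>

lemma fractional_integration_by_parts_box:
  fixes p :: "real ^ 'n \<Rightarrow> real"
  assumes p: "\<And>x. x \<in> box a b \<Longrightarrow> has_right_RL_deriv a b (\<alpha> $ k) k p x"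
    and Q: "continuous_on (box a b) (right_RL_deriv a b (\<alpha> $ k) k p)"
      "right_RL_deriv a b (\<alpha> $ k) k p absolutely_integrable_on cbox a b"
    and pint: "p absolutely_integrable_on cbox a b"
  shows "integral (cbox a b) (\<lambda>x. Deta k x * p x) = integral (cbox a b) (\<lambda>x. eta x * right_RL_deriv a b (\<alpha> $ k) k p x)"
proof -
  let ?Q = "right_RL_deriv a b (\<alpha> $ k) k p"
  let ?f = "\<lambda>x. Deta k x * p x - eta x * ?Q x"
  have 1: "(\<lambda>x. Deta k x * p x) absolutely_integrable_on cbox a b"
    by (rule absolutely_integrable_continuous_mult[OF Deta_continuous pint])
  have 2: "(\<lambda>x. eta x * ?Q x) absolutely_integrable_on cbox a b"
    by (rule absolutely_integrable_continuous_mult[OF eta_continuous Q(2)])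
  have 3: "?f absolutely_integrable_on box a b"
    unfolding absolutely_integrable_on_open_interval using 1 2 by (rule set_integral_diff)
  then have "integrable lebesgue (\<lambda>x. indicator (box a b) x * ?f x)"
    by (simp add: set_integrable_def)
  then have "(LINT x|lebesgue. indicator (box a b) x * ?f x) = 0"
    by (rule integral_zero_if_zero_along_coordinate[OF _ fractional_integration_by_parts_along_coordinate[OF p Q(1)]])
  then have "integral (box a b) ?f = 0"
    using set_lebesgue_integral_eq_integral(2)[OF 3] by (simp add: set_lebesgue_integral_def)
  then have "integral (cbox a b) ?f = 0"
    by (simp add: integral_open_interval)
  then show ?thesis
    using 1 2 by (simp add: Henstock_Kurzweil_Integration.integral_diff set_lebesgue_integral_eq_integral(1))
qed

end

section \<open>From the weak equation to the pointwise one\<close>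

locale fractional_minimizer =
  fixes a b \<alpha> :: "real ^ 'n"
    and L :: "(real ^ 'm) \<times> (real ^ 'n ^ 'm) \<Rightarrow> real"
    and DL :: "(real ^ 'm) \<times> (real ^ 'n ^ 'm) \<Rightarrow> ((real ^ 'm) \<times> (real ^ 'n ^ 'm)) \<Rightarrow>\<^sub>L real"
    and \<phi> u :: "real ^ 'n \<Rightarrow> real ^ 'm" and j :: 'm
  assumes alpha: "0 < \<alpha> $ i" "\<alpha> $ i < 1"
    and box: "a $ i < b $ i"
    and DL: "(L has_derivative blinfun_apply (DL z)) (at z)" "continuous_on UNIV DL"
    and regular: "x \<in> box a b \<Longrightarrow> has_right_RL_deriv a b (\<alpha> $ i) i (momentum a b \<alpha> L u j i) x"
      "continuous_on (box a b) (right_RL_deriv a b (\<alpha> $ i) i (momentum a b \<alpha> L u j i))"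
      "right_RL_deriv a b (\<alpha> $ i) i (momentum a b \<alpha> L u j i) absolutely_integrable_on cbox a b"
    and minimizer: "minimizes_action a b \<alpha> L \<phi> u"
begin

definition euler_lagrange_lhs :: "real ^ 'n \<Rightarrow> real" where
  "euler_lagrange_lhs x = partial_value L j (u x, frac_grad a b \<alpha> u x)
     + (\<Sum>i\<in>UNIV. right_RL_deriv a b (\<alpha> $ i) i (momentum a b \<alpha> L u j i) x)"

lemma admissible_u: "admissible a b \<alpha> \<phi> u"
  using minimizer by (simp add: minimizes_action_def)

lemma DL_apply_absolutely_integrable:
  "(\<lambda>x. blinfun_apply (DL (u x, frac_grad a b \<alpha> u x)) w) absolutely_integrable_on cbox a b"
proof -
  obtain R where "AE x in lebesgue_on (cbox a b). norm (u x, frac_grad a b \<alpha> u x) \<le> R"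
    using admissible_AE_bounded[OF _ box admissible_u] alpha by blast
  moreover have "continuous_on UNIV (\<lambda>z. blinfun_apply (DL z) w)"
    by (intro blinfun.continuous_on DL continuous_on_const)
  ultimately show ?thesis
    by (subst absolutely_integrable_on_iff_lebesgue_on)
      (auto intro!: integrable_continuous_compose_AE_bounded[OF _ admissible_measurable_Pair[OF admissible_u]])
qed

lemma partial_value_absolutely_integrable:
  "(\<lambda>x. partial_value L j (u x, frac_grad a b \<alpha> u x)) absolutely_integrable_on cbox a b"
  unfolding partial_value_eq[where DL = DL, OF DL(1)] by (rule DL_apply_absolutely_integrable)

lemma momentum_absolutely_integrable:
  "momentum a b \<alpha> L u j i absolutely_integrable_on cbox a b"
  unfolding momentum_def[abs_def] partial_grad_eq[where DL = DL, OF DL(1)] by (rule DL_apply_absolutely_integrable)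

lemma euler_lagrange_lhs_absolutely_integrable: "euler_lagrange_lhs absolutely_integrable_on cbox a b"
  unfolding euler_lagrange_lhs_def[abs_def]
  by (intro set_integral_add(1) absolutely_integrable_sum partial_value_absolutely_integrable regular(3)) auto

lemma weak_euler_lagrange:
  assumes "test_product a b c d \<alpha> h h'"
  shows "integral (cbox a b) (\<lambda>x. test_product.eta h x * euler_lagrange_lhs x) = 0"
proof -
  interpret test_product a b c d \<alpha> h h' by fact
  let ?PV = "\<lambda>x. partial_value L j (u x, frac_grad a b \<alpha> u x)"
  let ?p = "\<lambda>i. momentum a b \<alpha> L u j i"
  let ?Q = "\<lambda>i. right_RL_deriv a b (\<alpha> $ i) i (?p i)"
  have 1: "(\<lambda>x. eta x * ?PV x) absolutely_integrable_on cbox a b"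
    by (rule absolutely_integrable_continuous_mult[OF eta_continuous partial_value_absolutely_integrable])
  have 2: "(\<lambda>x. Deta i x * ?p i x) absolutely_integrable_on cbox a b" for i
    by (rule absolutely_integrable_continuous_mult[OF Deta_continuous momentum_absolutely_integrable])
  have 3: "(\<lambda>x. eta x * ?Q i x) absolutely_integrable_on cbox a b" for i
    by (rule absolutely_integrable_continuous_mult[OF eta_continuous regular(3)])
  have int: "integral (cbox a b) (\<lambda>x. f x + (\<Sum>i\<in>UNIV. g i x)) = integral (cbox a b) f + (\<Sum>i\<in>UNIV. integral (cbox a b) (g i))"
    if "f absolutely_integrable_on cbox a b" "\<And>i. g i absolutely_integrable_on cbox a b"
    for f :: "real ^ 'n \<Rightarrow> real" and g :: "'n \<Rightarrow> real ^ 'n \<Rightarrow> real"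
  proof -
    have g: "g i integrable_on cbox a b" for i
      using that(2) by (rule set_lebesgue_integral_eq_integral(1))
    have "f integrable_on cbox a b"
      using that(1) by (rule set_lebesgue_integral_eq_integral(1))
    moreover have "(\<lambda>x. \<Sum>i\<in>UNIV. g i x) integrable_on cbox a b"
      using g by (intro Henstock_Kurzweil_Integration.integrable_sum) auto
    ultimately show ?thesis
      using g by (simp add: Henstock_Kurzweil_Integration.integral_add Henstock_Kurzweil_Integration.integral_sum)
  qed
  have "(\<lambda>x. eta x * ?PV x + (\<Sum>i\<in>UNIV. Deta i x * ?p i x)) absolutely_integrable_on cbox a b"
    using 1 2 by (intro set_integral_add(1) absolutely_integrable_sum) auto
  then have "integral (cbox a b) (\<lambda>x. eta x * ?PV x + (\<Sum>i\<in>UNIV. Deta i x * ?p i x)) = 0"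
    using first_variation_zero[OF DL minimizer, of j]
    by (subst (asm) absolutely_integrable_on_iff_lebesgue_on) (simp_all add: lebesgue_integral_eq_integral)
  then have "integral (cbox a b) (\<lambda>x. eta x * ?PV x) + (\<Sum>i\<in>UNIV. integral (cbox a b) (\<lambda>x. Deta i x * ?p i x)) = 0"
    by (subst (asm) int[OF 1 2])
  moreover have "integral (cbox a b) (\<lambda>x. Deta i x * ?p i x) = integral (cbox a b) (\<lambda>x. eta x * ?Q i x)" for i
    by (rule fractional_integration_by_parts_box[OF regular momentum_absolutely_integrable])
  ultimately have "integral (cbox a b) (\<lambda>x. eta x * ?PV x) + (\<Sum>i\<in>UNIV. integral (cbox a b) (\<lambda>x. eta x * ?Q i x)) = 0"
    by simp
  then have "integral (cbox a b) (\<lambda>x. eta x * ?PV x + (\<Sum>i\<in>UNIV. eta x * ?Q i x)) = 0"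
    by (subst int[OF 1 3])
  then show ?thesis
    by (simp add: euler_lagrange_lhs_def distrib_left sum_distrib_left)
qed

text \<open>A sub-box may touch the faces of the large box while test functions may not, so the
  bumps live on slightly smaller boxes that grow to \<open>box c d\<close> as their slopes
  increase.\<close>

lemma integral_euler_lagrange_lhs_subbox:
  assumes cd: "\<And>i. a $ i \<le> c $ i" "\<And>i. c $ i < d $ i" "\<And>i. d $ i \<le> b $ i"
  shows "(LINT x|lebesgue. indicator (box c d) x * (indicator (box a b) x * euler_lagrange_lhs x)) = 0"
proof -
  let ?F = "\<lambda>x. indicator (box a b) x * euler_lagrange_lhs x"
  \<comment> \<open>Relative margin of the shrunken boxes. The double \<open>Suc\<close> gives at
    most 1/2 already for n = 0, so opposite faces never cross.\<close>
  define r :: "nat \<Rightarrow> real" where "r n = inverse (real (Suc (Suc n)))" for n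
  have r: "0 < r n" "r n \<le> 1 / 2" for n by (auto simp: r_def field_simps)
  have r0: "r \<longlonglongrightarrow> 0"
    unfolding r_def by (rule LIMSEQ_Suc[OF LIMSEQ_inverse_real_of_nat])
  define C where "C n = (\<chi> i. c $ i + (d $ i - c $ i) * r n)" for n
  define D where "D n = (\<chi> i. d $ i - (d $ i - c $ i) * r n)" for n
  define hn where "hn n i = bump (real n) (C n $ i) (D n $ i)" for n i
  define hn' where "hn' n i = bump_deriv (real n) (C n $ i) (D n $ i)" for n i
  have pos: "0 < (d $ i - c $ i) * r n" for n i using cd(2)[of i] r(1)[of n] by simp
  have CD: "C n $ i \<le> D n $ i" for n i
  proof -
    have "(d $ i - c $ i) * r n \<le> (d $ i - c $ i) * (1 / 2)"
      using cd(2)[of i] r(2)[of n] by (intro mult_left_mono) auto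
    then show ?thesis by (simp add: C_def D_def field_simps)
  qed
  have T: "test_product a b (C n) (D n) \<alpha> (hn n) (hn' n)" for n
  proof
    fix i t
    show "a $ i < C n $ i" "D n $ i < b $ i"
      using cd[of i] pos[of i n] by (auto simp: C_def D_def)
    show "(hn n i has_real_derivative hn' n i t) (at t)"
      unfolding hn_def hn'_def by (rule has_real_derivative_bump)
    show "t \<notin> {C n $ i<..<D n $ i} \<Longrightarrow> hn n i t = 0" "t \<notin> {C n $ i<..<D n $ i} \<Longrightarrow> hn' n i t = 0"
      unfolding hn_def hn'_def using bump_eq_0[OF CD] bump_deriv_eq_0[OF CD] by auto
    show "continuous_on UNIV (hn' n i)" unfolding hn'_def by (rule continuous_on_bump_deriv)
    show "\<exists>M. \<forall>t. \<bar>hn' n i t\<bar> \<le> M"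
      unfolding hn'_def using bump_deriv_bounded[OF CD[of n i], of "real n"] by blast
    show "\<bar>hn n i t\<bar> \<le> 1" unfolding hn_def by (rule abs_bump_le_1) simp
  qed (use alpha CD in auto)
  define e where "e n = test_product.eta (hn n)" for n
  have e_eq: "e n x = (\<Prod>i\<in>UNIV. hn n i (x $ i))" for n x
    unfolding e_def test_product.eta_def[OF T] ..
  have Fint: "integrable lebesgue ?F"
  proof -
    have "euler_lagrange_lhs absolutely_integrable_on box a b"
      using euler_lagrange_lhs_absolutely_integrable by (simp add: absolutely_integrable_on_open_interval)
    then show ?thesis by (simp add: set_integrable_def)
  qed
  have zero: "(LINT x|lebesgue. e n x * ?F x) = 0" for n
  proof -
    interpret test_product a b "C n" "D n" \<alpha> "hn n" "hn' n" by (rule T)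
    have "(\<lambda>x. eta x * euler_lagrange_lhs x) absolutely_integrable_on cbox a b"
      by (rule absolutely_integrable_continuous_mult[OF eta_continuous euler_lagrange_lhs_absolutely_integrable])
    then have "(LINT x:cbox a b|lebesgue. eta x * euler_lagrange_lhs x) = 0"
      using weak_euler_lagrange[OF T] by (subst set_lebesgue_integral_eq_integral(2)) auto
    moreover have "(\<lambda>x. indicator (cbox a b) x *\<^sub>R (eta x * euler_lagrange_lhs x)) = (\<lambda>x. e n x * ?F x)"
    proof
      fix x
      show "indicator (cbox a b) x *\<^sub>R (eta x * euler_lagrange_lhs x) = e n x * ?F x"
        using eta_eq_0[of x] box_subset_cbox[of a b] unfolding e_def by (cases "x \<in> box a b") auto
    qed
    ultimately show ?thesis by (simp only: set_lebesgue_integral_def)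
  qed
  have "(\<lambda>n. LINT x|lebesgue. e n x * ?F x) \<longlonglongrightarrow> (LINT x|lebesgue. indicator (box c d) x * ?F x)"
  \<comment> \<open>The bumps have unbounded derivatives as \<open>n\<close> grows, but the weak
    equation contains only their values, which are bounded by 1.\<close>
  proof (rule integral_dominated_convergence[where w = "\<lambda>x. \<bar>?F x\<bar>"])
    show "(\<lambda>x. indicator (box c d) x * ?F x) \<in> borel_measurable lebesgue"
      by (rule borel_measurable_times[OF borel_measurable_indicator borel_measurable_integrable[OF Fint]]) simp
    show "(\<lambda>x. e n x * ?F x) \<in> borel_measurable lebesgue" for n
    proof -
      have "e n \<in> borel_measurable borel"
        unfolding e_def by (intro borel_measurable_continuous_onI test_product.eta_continuous[OF T])
      then have "e n \<in> borel_measurable lebesgue" by (simp add: measurable_completion)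
      then show ?thesis by (rule borel_measurable_times[OF _ borel_measurable_integrable[OF Fint]])
    qed
    show "integrable lebesgue (\<lambda>x. \<bar>?F x\<bar>)" using Fint by (rule integrable_abs)
    show "AE x in lebesgue. (\<lambda>n. e n x * ?F x) \<longlonglongrightarrow> indicator (box c d) x * ?F x"
    proof (intro AE_I2 tendsto_mult_right)
      fix x :: "real ^ 'n"
      have "(\<lambda>n. \<Prod>i\<in>UNIV. hn n i (x $ i)) \<longlonglongrightarrow> (\<Prod>i\<in>UNIV. indicator {c $ i<..<d $ i} (x $ i))"
        unfolding hn_def
      proof (intro tendsto_prod tendsto_bump cd(2) CD)
        fix i
        show "c $ i \<le> C n $ i" "D n $ i \<le> d $ i" for n using pos[of i n] by (auto simp: C_def D_def)
        show "(\<lambda>n. C n $ i) \<longlonglongrightarrow> c $ i" "(\<lambda>n. D n $ i) \<longlonglongrightarrow> d $ i"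
          using tendsto_add[OF tendsto_const tendsto_mult[OF tendsto_const r0], of "c $ i" "d $ i - c $ i"]
            tendsto_diff[OF tendsto_const tendsto_mult[OF tendsto_const r0], of "d $ i" "d $ i - c $ i"]
          by (simp_all add: C_def D_def)
      qed
      moreover have "(\<Prod>i\<in>UNIV. indicator {c $ i<..<d $ i} (x $ i)) = (indicator (box c d) x :: real)"
        by (auto simp: indicator_def mem_box_cart prod_zero_iff)
      ultimately show "(\<lambda>n. e n x) \<longlonglongrightarrow> indicator (box c d) x" by (simp add: e_eq)
    qed
    show "AE x in lebesgue. norm (e n x * ?F x) \<le> \<bar>?F x\<bar>" for n
      using test_product.abs_eta_le_1[OF T] unfolding e_def
      by (intro AE_I2) (simp add: abs_mult mult_left_le_one_le)
  qed
  then show ?thesis unfolding zero by (simp add: LIMSEQ_const_iff)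
qed

lemma AE_euler_lagrange: "AE x in lebesgue. x \<in> box a b \<longrightarrow> euler_lagrange_lhs x = 0"
proof -
  let ?F = "\<lambda>x. indicator (box a b) x * euler_lagrange_lhs x"
  have "euler_lagrange_lhs absolutely_integrable_on box a b"
    using euler_lagrange_lhs_absolutely_integrable by (simp add: absolutely_integrable_on_open_interval)
  then have F: "integrable lebesgue ?F" by (simp add: set_integrable_def)
  have "AE x in lebesgue. ?F x = 0"
  proof (rule AE_zero_if_box_integrals_zero_lebesgue[OF F])
    fix c d :: "real ^ 'n"
    \<comment> \<open>Arbitrary test boxes are clipped to the domain; the clipped box is either
      nondegenerate or empty.\<close>
    define c' where "c' = (\<chi> i. max (a $ i) (c $ i))"
    define d' where "d' = (\<chi> i. min (b $ i) (d $ i))"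
    have eq: "(\<lambda>x. indicator (box c d) x * ?F x) = (\<lambda>x. indicator (box c' d') x * ?F x)"
      by (auto simp: fun_eq_iff indicator_def mem_box_cart c'_def d'_def)
    show "(LINT x|lebesgue. indicator (box c d) x * ?F x) = 0"
    proof (cases "\<forall>i. c' $ i < d' $ i")
      case True
      then show ?thesis
        unfolding eq by (intro integral_euler_lagrange_lhs_subbox) (auto simp: c'_def d'_def)
    next
      case False
      then obtain i where "\<not> c' $ i < d' $ i" by blast
      then have "box c' d' = {}"
        by (intro equals0I) (auto simp: mem_box_cart dest!: spec[of _ i])
      then show ?thesis unfolding eq by simp
    qed
  qed
  then show ?thesis by eventually_elim (auto simp: indicator_def)
qed

text \<open>The fractional gradient and the right derivatives are continuous inside the box, so
  continuity of \<open>u\<close> at \<open>x\<close> makes the whole left side continuous there. If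
  it were nonzero at \<open>x\<close>, it would be nonzero on a nonempty open set, which is not
  null.\<close>

lemma euler_lagrange_at_continuity_point:
  assumes x: "x \<in> box a b" and ux: "continuous (at x) u"
  shows "euler_lagrange_lhs x = 0"
proof (rule ccontr)
  assume ne: "euler_lagrange_lhs x \<noteq> 0"
  have "isCont (frac_grad a b \<alpha> u) x"
    using frac_grad_continuous[OF admissible_u] x continuous_on_subset[OF _ box_subset_cbox]
    by (metis continuous_on_eq_continuous_at open_box)
  then have "isCont (\<lambda>y. (u y, frac_grad a b \<alpha> u y)) x"
    using ux by (intro continuous_Pair)
  moreover have "isCont (\<lambda>z. blinfun_apply (DL z) (axis j 1, 0)) z" for z
  proof -
    have "isCont DL z" using DL(2) continuous_on_eq_continuous_at[OF open_UNIV] by blast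
    then show ?thesis by (intro blinfun.continuous continuous_const)
  qed
  ultimately have "isCont (\<lambda>y. blinfun_apply (DL (u y, frac_grad a b \<alpha> u y)) (axis j 1, 0)) x"
    by (rule isCont_o2)
  moreover have "isCont (right_RL_deriv a b (\<alpha> $ i) i (momentum a b \<alpha> L u j i)) x" for i
    using regular(2)[of i] x continuous_on_eq_continuous_at[OF open_box] by blast
  ultimately have "isCont euler_lagrange_lhs x"
    unfolding euler_lagrange_lhs_def[abs_def] partial_value_eq[where DL = DL, OF DL(1)]
    by (intro continuous_add continuous_sum) auto
  then obtain r where r: "0 < r" "\<And>y. dist x y < r \<Longrightarrow> euler_lagrange_lhs y \<noteq> 0"
    using ne continuous_at_avoid[where f = euler_lagrange_lhs and x = x and a = 0] by blast
  have "AE y in lebesgue. y \<notin> ball x r \<inter> box a b"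
    using AE_euler_lagrange by eventually_elim (use r in auto)
  then have "negligible (ball x r \<inter> box a b)"
    by (simp add: negligible_iff_null_sets AE_iff_null_sets)
  moreover have "open (ball x r \<inter> box a b)" by (intro open_Int open_ball open_box)
  moreover have "x \<in> ball x r \<inter> box a b" using x r(1) by simp
  ultimately show False using open_not_negligible by blast
qed

end

theorem theorem1:
  fixes a b \<alpha> :: "real ^ 'n"
    and L :: "(real ^ 'm) \<times> (real ^ 'n ^ 'm) \<Rightarrow> real"
    and \<phi> u :: "real ^ 'n \<Rightarrow> real ^ 'm"
  assumes alpha: "\<And>i. 0 < \<alpha> $ i \<and> \<alpha> $ i < 1"
    and box: "\<And>i. a $ i < b $ i"
    and C1: "C1_function L"
    and regular: "\<And>v i j. admissible a b \<alpha> \<phi> v \<Longrightarrow>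
        (\<forall>x\<in>box a b. has_right_RL_deriv a b (\<alpha> $ i) i (momentum a b \<alpha> L v j i) x) \<and>
        continuous_on (box a b) (right_RL_deriv a b (\<alpha> $ i) i (momentum a b \<alpha> L v j i)) \<and>
        right_RL_deriv a b (\<alpha> $ i) i (momentum a b \<alpha> L v j i) absolutely_integrable_on cbox a b"
    and minimizer: "minimizes_action a b \<alpha> L \<phi> u"
  shows "\<forall>j. (AE x in lebesgue. x \<in> box a b \<longrightarrow> euler_lagrange_at a b \<alpha> L u j x) \<and>
             (\<forall>x\<in>box a b. continuous (at x) u \<longrightarrow> euler_lagrange_at a b \<alpha> L u j x)"
proof
  fix j
  obtain DL where DL: "\<And>z. (L has_derivative blinfun_apply (DL z)) (at z)" "continuous_on UNIV DL"
    using C1 unfolding C1_function_def by blast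
  have u: "admissible a b \<alpha> \<phi> u" using minimizer by (simp add: minimizes_action_def)
  interpret fractional_minimizer a b \<alpha> L DL \<phi> u j
    using alpha box DL minimizer regular[OF u] by unfold_locales auto
  have eq: "euler_lagrange_at a b \<alpha> L u j x \<longleftrightarrow> euler_lagrange_lhs x = 0" for x
    by (simp add: euler_lagrange_at_def euler_lagrange_lhs_def)
  show "(AE x in lebesgue. x \<in> box a b \<longrightarrow> euler_lagrange_at a b \<alpha> L u j x) \<and>
             (\<forall>x\<in>box a b. continuous (at x) u \<longrightarrow> euler_lagrange_at a b \<alpha> L u j x)"
    unfolding eq using AE_euler_lagrange euler_lagrange_at_continuity_point by blast
qed

end
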